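(* Let $G$ be a finite group of order $n$, let $f:G\to\mathbb{Q}$ be a class function with $f(g)=f(g^{-1})$ for all $g\in G$, and let $\Gamma_f=\operatorname{Cay}(G,f)$. Let $H_f=\{h\in\mathbb{Z}_n^*\mid f^h=f\}$. Then $$\mathbb{SF}(\Gamma_f)=\mathbb{Q}(\zeta_n)^{\eta^{-1}(H_f)}=\{x\in\mathbb{Q}(\zeta_n)\mid \sigma(x)=x\text{ for all }\sigma\in\eta^{-1}(H_f)\},$$ and $$\operatorname{Deg}(\Gamma_f)=\frac{\varphi(n)}{|H_f|},$$ where $\varphi$ is Euler's totient function.
   Context: $\zeta_n=e^{2\pi i/n}$; $\mathbb{Z}_n^*$ is the unit group of $\mathbb{Z}/n\mathbb{Z}$; $\eta:\operatorname{Gal}(\mathbb{Q}(\zeta_n)/\mathbb{Q})\to\mathbb{Z}_n^*$ is the isomorphism with $\sigma(\zeta_n)=\zeta_n^{\eta(\sigma)}$. A class function is constant on conjugacy classes. For $h\in\mathbb{Z}_n^*$, $f^h(g)=f(g^h)$. The Cayley colour graph $\Gamma_f=\operatorname{Cay}(G,f)$ has vertex set $G$ and adjacency matrix $[f(gh^{-1})]_{g,h\in G}$; its eigenvalues are those of this matrix. $\mathbb{SF}(\Gamma_f)$ is the smallest subfield of $\mathbb{C}$ containing all eigenvalues of $\Gamma_f$, and the algebraic degree is $\operatorname{Deg}(\Gamma_f)=[\mathbb{SF}(\Gamma_f):\mathbb{Q}]$. *)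

theory Defs
  imports Complex_Main "HOL-Algebra.Group" "HOL-Number_Theory.Totient"
begin

definition subfield_C :: "complex set \<Rightarrow> bool" where
  "subfield_C S \<longleftrightarrow> 0 \<in> S \<and> 1 \<in> S \<and> (\<forall>x\<in>S. \<forall>y\<in>S. x + y \<in> S \<and> x * y \<in> S)
     \<and> (\<forall>x\<in>S. - x \<in> S) \<and> (\<forall>x\<in>S. x \<noteq> 0 \<longrightarrow> inverse x \<in> S)"

definition gen_field :: "complex set \<Rightarrow> complex set" where
  "gen_field A = \<Inter>{S. subfield_C S \<and> A \<subseteq> S}"

definition rat_degree :: "complex set \<Rightarrow> nat" where
  "rat_degree K = vector_space.dim (\<lambda>(r::rat) (z::complex). of_rat r * z) K"

definition class_function :: "('a, 'b) monoid_scheme \<Rightarrow> ('a \<Rightarrow> 'c) \<Rightarrow> bool" where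
  "class_function G f \<longleftrightarrow>
     (\<forall>g\<in>carrier G. \<forall>x\<in>carrier G. f (x \<otimes>\<^bsub>G\<^esub> g \<otimes>\<^bsub>G\<^esub> inv\<^bsub>G\<^esub> x) = f g)"

definition cayley_eigenvalues :: "('a, 'b) monoid_scheme \<Rightarrow> ('a \<Rightarrow> rat) \<Rightarrow> complex set" where
  "cayley_eigenvalues G f = {mu. \<exists>v :: 'a \<Rightarrow> complex. (\<exists>g\<in>carrier G. v g \<noteq> 0) \<and>
     (\<forall>g\<in>carrier G. (\<Sum>h\<in>carrier G. of_rat (f (g \<otimes>\<^bsub>G\<^esub> inv\<^bsub>G\<^esub> h)) * v h) = mu * v g)}"

definition SF :: "('a, 'b) monoid_scheme \<Rightarrow> ('a \<Rightarrow> rat) \<Rightarrow> complex set" where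
  "SF G f = gen_field (cayley_eigenvalues G f)"

definition Deg :: "('a, 'b) monoid_scheme \<Rightarrow> ('a \<Rightarrow> rat) \<Rightarrow> nat" where
  "Deg G f = rat_degree (SF G f)"

definition zeta :: "nat \<Rightarrow> complex" where
  "zeta n = cis (2 * pi / real n)"

definition cyclotomic_field :: "nat \<Rightarrow> complex set" where
  "cyclotomic_field n = gen_field {zeta n}"

text \<open>Field automorphisms of a subfield K of C (elements of Gal(K/Q)); values outside K irrelevant.\<close>
definition field_aut_C :: "complex set \<Rightarrow> (complex \<Rightarrow> complex) \<Rightarrow> bool" where
  "field_aut_C K \<sigma> \<longleftrightarrow> bij_betw \<sigma> K K \<and>
     (\<forall>x\<in>K. \<forall>y\<in>K. \<sigma> (x + y) = \<sigma> x + \<sigma> y \<and> \<sigma> (x * y) = \<sigma> x * \<sigma> y) \<and> \<sigma> 1 = 1"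

definition units_mod :: "nat \<Rightarrow> nat set" where
  "units_mod n = {h. h < n \<and> coprime h n}"

definition H_f :: "('a, 'b) monoid_scheme \<Rightarrow> ('a \<Rightarrow> 'c) \<Rightarrow> nat \<Rightarrow> nat set" where
  "H_f G f n = {h \<in> units_mod n. \<forall>g\<in>carrier G. f (g [^]\<^bsub>G\<^esub> h) = f g}"

definition eta_preimage :: "nat \<Rightarrow> nat set \<Rightarrow> (complex \<Rightarrow> complex) set" where
  "eta_preimage n H = {\<sigma>. field_aut_C (cyclotomic_field n) \<sigma> \<and> (\<exists>h\<in>H. \<sigma> (zeta n) = zeta n ^ h)}"

definition fixed_field :: "complex set \<Rightarrow> (complex \<Rightarrow> complex) set \<Rightarrow> complex set" where
  "fixed_field K S = {x \<in> K. \<forall>\<sigma>\<in>S. \<sigma> x = x}"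

end

theory Submission
  imports Defs
    "HOL-Computational_Algebra.Computational_Algebra"
    "HOL-Number_Theory.Cong"
    "HOL-Algebra.Multiplicative_Group"
    "Jordan_Normal_Form.Schur_Decomposition"
begin

text \<open>
  The adjacency matrix of \<open>Cay(G, f)\<close> is convolution by \<open>f\<close> on the group algebra. As the centre of
  the complex group algebra is reduced, \<open>f = \<Sum>\<^sub>\<mu> \<mu> e\<^sub>\<mu>\<close> with \<open>\<mu>\<close> ranging over the eigenvalues and
  \<open>e\<^sub>\<mu>\<close> nonzero central idempotents. An idempotent of the group algebra has rational value at the
  identity (it is a trace divided by \<open>n\<close>), so the discrete Fourier transform of \<open>j \<mapsto> e\<^sub>\<mu>(g\<^sup>j)\<close> is
  rational; therefore \<open>e\<^sub>\<mu>(g)\<close> lies in the cyclotomic field and the automorphism \<open>\<zeta> \<mapsto> \<zeta>\<^sup>h\<close> sends it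
  to \<open>e\<^sub>\<mu>(g\<^sup>h)\<close>. Comparing \<open>f(g) = \<Sum>\<^sub>\<mu> \<mu> e\<^sub>\<mu>(g)\<close> and \<open>\<mu> e\<^sub>\<mu>(1) = \<Sum>\<^sub>g f(g\<^sup>-\<^sup>1) e\<^sub>\<mu>(g)\<close> with their
  conjugates shows that this automorphism fixes every eigenvalue iff \<open>f\<^sup>h = f\<close>, and Galois theory
  of the cyclotomic field does the rest.
\<close>

hide_const (open) up_ring.coeff up_ring.monom module.smult

section \<open>Simple extensions of subfields of the complex numbers\<close>

text \<open>In terms of characters, each idempotent used is the sum of the primitive central
  idempotents of all irreducible characters with the same eigenvalue. These coarser sums are
  polynomials in \<open>f\<close>, so Lagrange interpolation reaches them without representation
  theory. Their Fourier coefficients along the powers of g are tractable because averaging those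
  powers against an n-th root of unity gives an idempotent (possibly zero), which commutes with the
  central e; the product is again idempotent. It need not be central, so rationality at the identity
  has to be proved for arbitrary idempotents. On the field side, counting roots replaces the
  fundamental theorem of Galois theory. For F inside Q(zeta_n), the minimal polynomial m of zeta_n
  over F divides X^n - 1, hence its roots are exactly deg m powers of zeta_n, and their exponents
  play the role of Gal(Q(zeta_n)/F). For F = Q these are all units, for F = SF they are H_f, and the
  quotient of the two counts is the degree.\<close>

definition polys_over :: "complex set \<Rightarrow> complex poly set" where
  "polys_over F = {p. \<forall>i. coeff p i \<in> F}"

text \<open>This is the ring F[x]; it is a field only once x is algebraic over F
  (\<open>subfield_adjoin\<close>).\<close>

definition adjoin :: "complex set \<Rightarrow> complex \<Rightarrow> complex set" where
  "adjoin F x = (\<lambda>p. poly p x) ` polys_over F"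

text \<open>Least degree stands in for irreducibility, and no normalisation is made: only the
  degree, the roots and divisibility matter later.\<close>

definition is_minpoly :: "complex set \<Rightarrow> complex \<Rightarrow> complex poly \<Rightarrow> bool" where
  "is_minpoly F x m \<longleftrightarrow> m \<in> polys_over F \<and> m \<noteq> 0 \<and> poly m x = 0 \<and>
     (\<forall>p\<in>polys_over F. p \<noteq> 0 \<longrightarrow> poly p x = 0 \<longrightarrow> degree m \<le> degree p)"

locale complex_subfield =
  fixes F :: "complex set"
  assumes subfield: "subfield_C F"
begin

lemma zero_closed [simp, intro]: "0 \<in> F"
  and one_closed [simp, intro]: "1 \<in> F"
  and add_closed [intro]: "x \<in> F \<Longrightarrow> y \<in> F \<Longrightarrow> x + y \<in> F"
  and mult_closed [intro]: "x \<in> F \<Longrightarrow> y \<in> F \<Longrightarrow> x * y \<in> F"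
  and uminus_closed [intro]: "x \<in> F \<Longrightarrow> - x \<in> F"
  using subfield by (auto simp: subfield_C_def)

lemma inverse_closed [intro]: "x \<in> F \<Longrightarrow> inverse x \<in> F"
  using subfield by (cases "x = 0") (auto simp: subfield_C_def)

lemma diff_closed [intro]: "x \<in> F \<Longrightarrow> y \<in> F \<Longrightarrow> x - y \<in> F"
  using add_closed[of x "- y"] by auto

lemma divide_closed [intro]: "x \<in> F \<Longrightarrow> y \<in> F \<Longrightarrow> x / y \<in> F"
  by (auto simp: divide_inverse)

lemma sum_closed [intro]: "(\<And>i. i \<in> A \<Longrightarrow> g i \<in> F) \<Longrightarrow> sum g A \<in> F"
  by (induction A rule: infinite_finite_induct) auto

lemma power_closed [intro]: "x \<in> F \<Longrightarrow> x ^ k \<in> F"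
  by (induction k) auto

lemma of_nat_closed [simp, intro]: "of_nat k \<in> F"
  by (induction k) auto

lemma of_int_closed [simp, intro]: "of_int k \<in> F"
  by (cases k) (auto simp del: of_nat_Suc)

lemma of_rat_closed [simp, intro]: "of_rat r \<in> F"
  by (cases r) (auto simp: of_rat_rat)

lemma zero_polys_over [simp, intro]: "0 \<in> polys_over F"
  and one_polys_over [simp, intro]: "1 \<in> polys_over F"
  by (auto simp: polys_over_def coeff_1)

lemma pCons_polys_over [simp]: "pCons a p \<in> polys_over F \<longleftrightarrow> a \<in> F \<and> p \<in> polys_over F"
proof
  assume h: "pCons a p \<in> polys_over F"
  then have "coeff (pCons a p) 0 \<in> F" "\<And>i. coeff (pCons a p) (Suc i) \<in> F"
    unfolding polys_over_def by blast+
  then show "a \<in> F \<and> p \<in> polys_over F" by (auto simp: polys_over_def)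
qed (auto simp: polys_over_def coeff_pCons split: nat.splits)

lemma add_polys_over [intro]: "p \<in> polys_over F \<Longrightarrow> q \<in> polys_over F \<Longrightarrow> p + q \<in> polys_over F"
  and diff_polys_over [intro]: "p \<in> polys_over F \<Longrightarrow> q \<in> polys_over F \<Longrightarrow> p - q \<in> polys_over F"
  and mult_polys_over [intro]: "p \<in> polys_over F \<Longrightarrow> q \<in> polys_over F \<Longrightarrow> p * q \<in> polys_over F"
  and uminus_polys_over [intro]: "p \<in> polys_over F \<Longrightarrow> - p \<in> polys_over F"
  and monom_polys_over [intro]: "a \<in> F \<Longrightarrow> monom a k \<in> polys_over F"
  by (auto simp: polys_over_def coeff_mult)

lemma sum_polys_over [intro]: "(\<And>i. i \<in> A \<Longrightarrow> g i \<in> polys_over F) \<Longrightarrow> sum g A \<in> polys_over F"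
  by (induction A rule: infinite_finite_induct) auto

lemma pcompose_polys_over [intro]:
  "p \<in> polys_over F \<Longrightarrow> q \<in> polys_over F \<Longrightarrow> pcompose p q \<in> polys_over F"
  by (induction p) (auto simp: pcompose_pCons)

lemma poly_closed: "p \<in> polys_over F \<Longrightarrow> x \<in> F \<Longrightarrow> poly p x \<in> F"
  by (induction p) auto

text \<open>Long division, redone because F is a set and not a type: the leading term is cancelled
  by a monomial whose coefficient is a quotient in F, so quotient and remainder stay over F.\<close>

lemma polys_over_division:
  assumes "m \<in> polys_over F" "m \<noteq> 0" "p \<in> polys_over F"
  shows "\<exists>q\<in>polys_over F. \<exists>r\<in>polys_over F. p = m * q + r \<and> (r = 0 \<or> degree r < degree m)"
  using assms(3)
proof (induction "degree p" arbitrary: p rule: less_induct)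
  case less
  show ?case
  proof (cases "p = 0 \<or> degree p < degree m")
    case True
    then show ?thesis using less.prems by (intro bexI[of _ 0] bexI[of _ p]) auto
  next
    case False
    define t where "t = monom (lead_coeff p / lead_coeff m) (degree p - degree m)"
    have t: "t \<in> polys_over F"
      using less.prems assms(1) unfolding t_def by (auto simp: polys_over_def)
    have t0: "t \<noteq> 0" using False assms(2) by (auto simp: t_def)
    have "degree t = degree p - degree m" "lead_coeff t = lead_coeff p / lead_coeff m"
      using False assms(2) by (auto simp: t_def degree_monom_eq)
    then have dt: "degree (m * t) = degree p" "lead_coeff (m * t) = lead_coeff p"
      using False assms(2) t0 degree_mult_eq[of m t] lead_coeff_mult[of m t] by auto
    define p' where "p' = p - m * t"
    have p': "p' \<in> polys_over F" using t less.prems assms(1) by (auto simp: p'_def)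
    have split: "p = m * t + p'" by (simp add: p'_def)
    show ?thesis
    proof (cases "p' = 0 \<or> degree p' < degree m")
      case True
      then show ?thesis using t p' split by blast
    next
      case F2: False
      have "degree p' < degree p"
      proof -
        have "degree p' \<le> degree p" unfolding p'_def using dt(1) by (intro degree_diff_le) auto
        moreover have "coeff p' (degree p) = 0" unfolding p'_def using dt by simp
        ultimately show ?thesis using F2
          by (metis le_neq_implies_less leading_coeff_0_iff)
      qed
      from less.hyps[OF this p'] obtain q r where
        "q \<in> polys_over F" "r \<in> polys_over F" "p' = m * q + r" "r = 0 \<or> degree r < degree m"
        by blast
      then show ?thesis using split t
        by (intro bexI[of _ "t + q"] bexI[of _ r]) (auto simp: algebra_simps)
    qed
  qed
qed

lemma minpoly_exists:
  assumes "p \<in> polys_over F" "p \<noteq> 0" "poly p x = 0"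
  shows "\<exists>m. is_minpoly F x m"
proof -
  let ?P = "\<lambda>p. p \<in> polys_over F \<and> p \<noteq> 0 \<and> poly p x = 0"
  obtain m where "?P m" "\<forall>q. ?P q \<longrightarrow> degree m \<le> degree q"
    using ex_has_least_nat[of ?P p degree] assms by blast
  then show ?thesis unfolding is_minpoly_def by blast
qed

lemma minpoly_dvd:
  assumes "is_minpoly F x m" "p \<in> polys_over F" "poly p x = 0"
  shows "m dvd p"
proof -
  from polys_over_division[of m p] assms obtain q r where
    qr: "q \<in> polys_over F" "r \<in> polys_over F" "p = m * q + r" "r = 0 \<or> degree r < degree m"
    by (auto simp: is_minpoly_def)
  have "poly r x = 0" using qr(3) assms by (auto simp: is_minpoly_def)
  then have "r = 0" using qr assms by (auto simp: is_minpoly_def)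
  then show ?thesis using qr by auto
qed

lemma degree_minpoly_pos: "is_minpoly F x m \<Longrightarrow> 0 < degree m"
  by (auto simp: is_minpoly_def elim!: degree_eq_zeroE intro!: Nat.gr0I)

lemma adjoin_eq_reduced:
  assumes "is_minpoly F x m" "y \<in> adjoin F x"
  shows "\<exists>p\<in>polys_over F. (p = 0 \<or> degree p < degree m) \<and> y = poly p x"
proof -
  obtain p where p: "p \<in> polys_over F" "y = poly p x" using assms by (auto simp: adjoin_def)
  from polys_over_division[of m p] assms p obtain q r where
    qr: "q \<in> polys_over F" "r \<in> polys_over F" "p = m * q + r" "r = 0 \<or> degree r < degree m"
    by (auto simp: is_minpoly_def)
  then show ?thesis using p assms by (intro bexI[of _ r]) (auto simp: is_minpoly_def)
qed

text \<open>Dividing m by p leaves a remainder r of smaller degree with r(x) = - p(x) q(x), so an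
  inverse of r(x) yields one of p(x). If r were 0, then q would annihilate x in degree below that of
  m.\<close>

lemma adjoin_inverse:
  assumes m: "is_minpoly F x m" and "p \<in> polys_over F" "p \<noteq> 0" "degree p < degree m"
  shows "\<exists>q\<in>polys_over F. poly p x * poly q x = 1"
  using assms(2-)
proof (induction "degree p" arbitrary: p rule: less_induct)
  case less
  have mF: "m \<in> polys_over F" "m \<noteq> 0" "poly m x = 0" using m by (auto simp: is_minpoly_def)
  have px: "poly p x \<noteq> 0" using m less.prems by (auto simp: is_minpoly_def)
  show ?case
  proof (cases "degree p = 0")
    case True
    then obtain a where "p = [:a:]" by (auto elim: degree_eq_zeroE)
    then show ?thesis using less.prems by (intro bexI[of _ "[:inverse a:]"]) auto
  next
    case False
    from polys_over_division[of p m] less.prems mF obtain q r where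
      qr: "q \<in> polys_over F" "r \<in> polys_over F" "m = p * q + r" "r = 0 \<or> degree r < degree p"
      by blast
    have "r \<noteq> 0"
    proof
      assume r0: "r = 0"
      then have "q \<noteq> 0" "poly q x = 0" using qr mF px by auto
      moreover have "degree m = degree p + degree q"
        using r0 qr(3) less.prems \<open>q \<noteq> 0\<close> by (simp add: degree_mult_eq)
      ultimately show False using m qr(1) False by (auto simp: is_minpoly_def)
    qed
    with qr less obtain s where s: "s \<in> polys_over F" "poly r x * poly s x = 1"
      by (metis order.strict_trans)
    have "poly r x = - poly p x * poly q x" using qr(3) mF(3)
      by (metis add.commute minus_mult_left neg_eq_iff_add_eq_0 poly_add poly_mult)
    then have "poly p x * poly (- q * s) x = 1" using s by (simp add: mult.assoc)
    then show ?thesis using qr s by blast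
  qed
qed

lemma subfield_adjoin:
  assumes m: "is_minpoly F x m"
  shows "subfield_C (adjoin F x)"
  unfolding subfield_C_def
proof (intro conjI ballI impI)
  show "0 \<in> adjoin F x" "1 \<in> adjoin F x" unfolding adjoin_def
    by (auto intro: image_eqI[of _ _ 0] image_eqI[of _ _ 1])
next
  fix y z assume "y \<in> adjoin F x" "z \<in> adjoin F x"
  then obtain p q where "p \<in> polys_over F" "q \<in> polys_over F" "y = poly p x" "z = poly q x"
    by (auto simp: adjoin_def)
  then show "y + z \<in> adjoin F x" "y * z \<in> adjoin F x" unfolding adjoin_def
    by (auto intro: image_eqI[of _ _ "p + q"] image_eqI[of _ _ "p * q"])
next
  fix y assume y: "y \<in> adjoin F x"
  then obtain p where "p \<in> polys_over F" "y = poly p x" by (auto simp: adjoin_def)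
  then show "- y \<in> adjoin F x" unfolding adjoin_def by (auto intro: image_eqI[of _ _ "- p"])
  assume "y \<noteq> 0"
  from adjoin_eq_reduced[OF m y] obtain p where
    p: "p \<in> polys_over F" "p = 0 \<or> degree p < degree m" "y = poly p x" by blast
  with \<open>y \<noteq> 0\<close> have "p \<noteq> 0" by auto
  with adjoin_inverse[OF m p(1)] p obtain q where "q \<in> polys_over F" "y * poly q x = 1" by auto
  then show "inverse y \<in> adjoin F x" unfolding adjoin_def
    by (metis image_eqI inverse_unique)
qed

lemma const_in_adjoin: "c \<in> F \<Longrightarrow> c \<in> adjoin F x"
  unfolding adjoin_def by (auto intro: image_eqI[of _ _ "[:c:]"])

lemma self_in_adjoin: "x \<in> adjoin F x"
  unfolding adjoin_def by (auto intro: image_eqI[of _ _ "[:0, 1:]"])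

end

lemma subfield_gen_field: "subfield_C (gen_field A)"
  unfolding gen_field_def subfield_C_def by auto

lemma gen_field_contains: "A \<subseteq> gen_field A"
  unfolding gen_field_def by auto

lemma gen_field_minimal: "subfield_C S \<Longrightarrow> A \<subseteq> S \<Longrightarrow> gen_field A \<subseteq> S"
  unfolding gen_field_def by auto

text \<open>Since F already lies in the field generated by x, adjoining x to F gives nothing larger.
  This describes one cyclotomic field as F[x] for different base fields F.\<close>

lemma gen_field_singleton_eq_adjoin:
  assumes F: "subfield_C F" "F \<subseteq> gen_field {x}" and m: "is_minpoly F x m"
  shows "gen_field {x} = adjoin F x"
proof
  interpret F: complex_subfield F by standard (rule F)
  interpret K: complex_subfield "gen_field {x}" by standard (rule subfield_gen_field)
  show "gen_field {x} \<subseteq> adjoin F x"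
    by (rule gen_field_minimal[OF F.subfield_adjoin[OF m]]) (auto intro: F.self_in_adjoin)
  show "adjoin F x \<subseteq> gen_field {x}"
    using gen_field_contains[of "{x}"] F(2)
    by (fastforce simp: adjoin_def polys_over_def intro!: K.poly_closed)
qed

section \<open>Degrees over the rationals\<close>

interpretation Qvs: vector_space "\<lambda>(r::rat) (z::complex). of_rat r * z"
  by standard (auto simp: algebra_simps of_rat_add of_rat_mult)

text \<open>The elements \<open>b * x ^ j\<close>, for \<open>b\<close> in a rational basis of \<open>F\<close> and \<open>j < degree m\<close>, form a
  rational basis; for infinite-dimensional \<open>F\<close> both sides are the junk value 0.\<close>
lemma (in complex_subfield) rat_degree_adjoin:
  assumes m: "is_minpoly F x m"
  shows "rat_degree (adjoin F x) = rat_degree F * degree m"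
proof -
  interpret K: complex_subfield "adjoin F x" by standard (rule subfield_adjoin[OF m])
  let ?d = "degree m"
  obtain B where B: "B \<subseteq> F" "Qvs.independent B" "F \<subseteq> Qvs.span B" "card B = Qvs.dim F"
    using Qvs.basis_exists by blast
  define g where "g = (\<lambda>(b, j). b * x ^ j)"
  let ?S = "g ` (B \<times> {..<?d})"
  \<comment> \<open>The coefficients are indexed by pairs and not by products, so that the same fact
    yields both the injectivity of \<open>g\<close> and the independence of its image. Collecting by
    powers of x gives a polynomial over F of degree below \<open>?d\<close> that vanishes at x,
    hence 0.\<close>
  have zero: "u (b, j) = 0"
    if fin: "finite B'" and B': "B' \<subseteq> B" and sum0: "(\<Sum>t\<in>B' \<times> {..<?d}. of_rat (u t) * g t) = 0"
      and b: "b \<in> B'" and j: "j < ?d" for B' and u :: "complex \<times> nat \<Rightarrow> rat" and b j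
  proof -
    define c where "c = (\<lambda>j. \<Sum>b\<in>B'. of_rat (u (b, j)) * b)"
    define p where "p = (\<Sum>j<?d. monom (c j) j)"
    have cF: "c i \<in> F" for i using B(1) B' by (auto simp: c_def)
    have pF: "p \<in> polys_over F" using cF by (auto simp: p_def)
    have "poly p x = (\<Sum>j<?d. \<Sum>b\<in>B'. of_rat (u (b, j)) * g (b, j))"
      by (simp add: p_def c_def poly_sum poly_monom sum_distrib_right g_def mult.assoc)
    also have "\<dots> = (\<Sum>t\<in>B' \<times> {..<?d}. of_rat (u t) * g t)"
      by (subst sum.swap) (simp add: sum.cartesian_product)
    finally have "poly p x = 0" using sum0 by simp
    moreover have "degree p < ?d"
      unfolding p_def using degree_minpoly_pos[OF m]
      by (intro degree_sum_less) (auto intro: le_less_trans[OF degree_monom_le])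
    ultimately have "p = 0" using m pF by (auto simp: is_minpoly_def)
    then have "coeff p j = 0" by simp
    then have "c j = 0" using j by (simp add: p_def coeff_sum)
    then have "\<forall>v\<in>B'. u (v, j) = 0"
      using B(2) fin B' unfolding Qvs.dependent_explicit c_def
      by (auto dest: spec[of _ B'] spec[of _ "\<lambda>v. u (v, j)"])
    then show ?thesis using b by blast
  qed
  have inj: "inj_on g (B \<times> {..<?d})"
  proof (rule inj_onI)
    fix s t assume st: "s \<in> B \<times> {..<?d}" "t \<in> B \<times> {..<?d}" "g s = g t"
    show "s = t"
    proof (rule ccontr)
      assume ne: "s \<noteq> t"
      \<comment> \<open>Two equal products would be a relation with coefficients 1 and -1.\<close>
      let ?u = "\<lambda>r. if r = s then 1 else if r = t then - 1 else (0::rat)"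
      let ?X = "{fst s, fst t} \<times> {..<?d}"
      have fX: "finite ?X" by simp
      have "(\<Sum>r\<in>?X. of_rat (?u r) * g r) = (\<Sum>r\<in>{s, t}. of_rat (?u r) * g r)"
        using st by (intro sum.mono_neutral_right[OF fX]) (auto simp: mem_Times_iff)
      also have "\<dots> = 0" using ne st(3) by (simp add: of_rat_minus)
      finally have "?u (fst s, snd s) = 0" by (rule zero[rotated 2]) (use st in auto)
      then show False by simp
    qed
  qed
  have "Qvs.independent ?S"
    unfolding Qvs.dependent_explicit
  proof safe
    fix T u v assume T: "finite T" "T \<subseteq> ?S" "(\<Sum>v\<in>T. of_rat (u v) * v) = 0" "v \<in> T" "u v \<noteq> 0"
    then obtain T' where T': "T' \<subseteq> B \<times> {..<?d}" "T = g ` T'" by (meson subset_image_iff)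
    have injT: "inj_on g T'" using inj T'(1) by (rule inj_on_subset)
    have finT: "finite T'" using T(1) T' injT finite_imageD by blast
    \<comment> \<open>The relation is pulled back along \<open>g\<close> and padded with zeros to a
      full rectangle, the shape that \<open>zero\<close> expects.\<close>
    let ?u = "\<lambda>t. if t \<in> T' then u (g t) else 0"
    have "(\<Sum>t\<in>(fst ` T') \<times> {..<?d}. of_rat (?u t) * g t) = (\<Sum>t\<in>T'. of_rat (?u t) * g t)"
      using finT T'(1) by (intro sum.mono_neutral_right) (auto simp: rev_image_eqI)
    also have "\<dots> = (\<Sum>v\<in>T. of_rat (u v) * v)"
      unfolding T'(2) by (simp add: sum.reindex[OF injT])
    finally have s0: "(\<Sum>t\<in>(fst ` T') \<times> {..<?d}. of_rat (?u t) * g t) = 0" using T(3) by simp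
    from T T' obtain b j where bj: "(b, j) \<in> T'" "v = g (b, j)" by auto
    have "?u (b, j) = 0"
      by (rule zero[OF _ _ s0]) (use finT T'(1) bj in \<open>auto simp: rev_image_eqI\<close>)
    then show False using bj T(5) by simp
  qed
  moreover have "Qvs.span ?S = Qvs.span (adjoin F x)"
  proof
    have "?S \<subseteq> adjoin F x"
    proof safe
      fix b j assume "b \<in> B"
      then show "g (b, j) \<in> adjoin F x"
        using B(1) const_in_adjoin[of b x] self_in_adjoin[of x] by (auto simp: g_def)
    qed
    then show "Qvs.span ?S \<subseteq> Qvs.span (adjoin F x)" by (rule Qvs.span_mono)
    have monomial: "c * x ^ j \<in> Qvs.span ?S" if "c \<in> F" "j < ?d" for c j
    proof -
      have "c \<in> Qvs.span B" using that B by blast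
      then show ?thesis
      proof (induction rule: Qvs.span_induct_alt)
        case base
        show ?case by (simp add: Qvs.span_zero)
      next
        case (step r b y)
        have "b * x ^ j \<in> Qvs.span ?S"
          by (rule Qvs.span_base) (use step that in \<open>auto simp: g_def intro!: image_eqI[of _ _ "(b, j)"]\<close>)
        then have "of_rat r * (b * x ^ j) \<in> Qvs.span ?S" by (rule Qvs.span_scale)
        from Qvs.span_add[OF this step(2)] show ?case by (simp add: algebra_simps)
      qed
    qed
    have "adjoin F x \<subseteq> Qvs.span ?S"
    proof
      fix y assume "y \<in> adjoin F x"
      from adjoin_eq_reduced[OF m this] obtain p where
        p: "p \<in> polys_over F" "p = 0 \<or> degree p < ?d" "y = poly p x" by blast
      show "y \<in> Qvs.span ?S"
      proof (cases "p = 0")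
        case False
        then have "y = (\<Sum>i\<le>degree p. coeff p i * x ^ i)" using p by (simp add: poly_altdef)
        also have "\<dots> \<in> Qvs.span ?S"
          using p False by (intro Qvs.span_sum monomial) (auto simp: polys_over_def)
        finally show ?thesis .
      qed (use p in \<open>simp add: Qvs.span_zero\<close>)
    qed
    then show "Qvs.span (adjoin F x) \<subseteq> Qvs.span ?S"
      by (simp add: Qvs.span_minimal Qvs.subspace_span)
  qed
  ultimately have "Qvs.dim (adjoin F x) = card ?S" using Qvs.dim_eq_card by blast
  then show ?thesis using B(4) inj by (simp add: rat_degree_def card_image card_cartesian_product)
qed

section \<open>Galois theory of cyclotomic extensions\<close>

lemma zeta_power: "zeta n ^ k = cis (2 * pi * real k / real n)"
  by (simp add: zeta_def DeMoivre mult_ac)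

lemma zeta_power_self [simp]: "0 < n \<Longrightarrow> zeta n ^ n = 1"
  by (simp add: zeta_power)

lemma zeta_nonzero [simp]: "zeta n \<noteq> 0"
  by (simp add: zeta_def)

lemma zeta_power_mod: "zeta n ^ (k mod n) = zeta n ^ k"
proof (cases "n = 0")
  case False
  have "zeta n ^ k = zeta n ^ (n * (k div n) + k mod n)" by simp
  also have "\<dots> = zeta n ^ (k mod n)" unfolding power_add power_mult using False by simp
  finally show ?thesis by simp
qed auto

lemma bij_betw_zeta_power: "0 < n \<Longrightarrow> bij_betw (\<lambda>k. zeta n ^ k) {..<n} {z. z ^ n = 1}"
  unfolding zeta_power by (rule bij_betw_roots_unity)

lemma zeta_power_eq_iff:
  assumes "0 < n"
  shows "zeta n ^ i = zeta n ^ j \<longleftrightarrow> [i = j] (mod n)"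
proof -
  have "inj_on (\<lambda>k. zeta n ^ k) {..<n}" using bij_betw_zeta_power[OF assms] by (simp add: bij_betw_def)
  then have "zeta n ^ (i mod n) = zeta n ^ (j mod n) \<longleftrightarrow> i mod n = j mod n"
    using assms by (auto simp: inj_on_def)
  then show ?thesis by (simp add: zeta_power_mod cong_def)
qed

lemma zeta_power_eq_1_iff: "0 < n \<Longrightarrow> zeta n ^ k = 1 \<longleftrightarrow> n dvd k"
  using zeta_power_eq_iff[of n k 0] by (simp add: cong_0_iff)

lemma poly_zero_of_dvd: "m dvd p \<Longrightarrow> poly m y = 0 \<Longrightarrow> poly p y = 0"
  for m p :: "'a :: comm_ring_1 poly"
  by (auto elim: dvdE)

text \<open>Write m = m' q with m' minimal for y. One of m' and q vanishes at x; if it is q, then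
  deg m is at most deg q, which is impossible because m' has positive degree.\<close>

lemma (in complex_subfield) minpoly_conjugate:
  assumes m: "is_minpoly F x m" and y: "poly m y = 0"
  shows "is_minpoly F y m"
proof -
  have mF: "m \<in> polys_over F" "m \<noteq> 0" "poly m x = 0" using m by (auto simp: is_minpoly_def)
  obtain m' where m': "is_minpoly F y m'" using minpoly_exists[OF mF(1,2) y] by blast
  then have m'F: "m' \<in> polys_over F" "m' \<noteq> 0" "poly m' y = 0" by (auto simp: is_minpoly_def)
  obtain q r where
    qr: "q \<in> polys_over F" "r \<in> polys_over F" "m = m' * q + r" "r = 0 \<or> degree r < degree m'"
    using polys_over_division[OF m'F(1,2) mF(1)] by blast
  have "poly r y = 0" using qr(3) y m'F by simp
  then have r: "r = 0" using qr m' by (auto simp: is_minpoly_def)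
  have q0: "q \<noteq> 0" using r qr mF by auto
  have deg: "degree m = degree m' + degree q" using r qr m'F q0 by (simp add: degree_mult_eq)
  have "degree m \<le> degree m'"
  proof (cases "poly m' x = 0")
    case True
    then show ?thesis using m m'F by (auto simp: is_minpoly_def)
  next
    case False
    then have "poly q x = 0" using mF(3) qr(3) r by simp
    then have "degree m \<le> degree q" using m qr(1) q0 by (auto simp: is_minpoly_def)
    then show ?thesis using degree_minpoly_pos[OF m'] deg by simp
  qed
  then show ?thesis using m' mF y unfolding is_minpoly_def by (meson order_trans)
qed

lemma field_aut_zero:
  assumes "subfield_C K" "field_aut_C K \<sigma>"
  shows "\<sigma> 0 = 0"
proof -
  have "\<sigma> (0 + 0) = \<sigma> 0 + \<sigma> 0" using assms unfolding field_aut_C_def subfield_C_def by blast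
  then show ?thesis by simp
qed

lemma field_aut_poly:
  assumes K: "subfield_C K" "field_aut_C K \<sigma>" and p: "p \<in> polys_over K"
    and fixd: "\<And>i. \<sigma> (coeff p i) = coeff p i" and x: "x \<in> K"
  shows "\<sigma> (poly p x) = poly p (\<sigma> x)"
proof -
  interpret complex_subfield K by standard (rule K)
  show ?thesis using p fixd
  proof (induction p)
    case 0
    then show ?case by (simp add: field_aut_zero[OF K])
  next
    case (pCons a p)
    have fa: "\<sigma> a = a" using pCons.prems(2)[of 0] by simp
    have fp: "\<sigma> (coeff p i) = coeff p i" for i using pCons.prems(2)[of "Suc i"] by simp
    have "poly p x \<in> K" "a \<in> K" "p \<in> polys_over K" using pCons.prems x by (auto intro: poly_closed)
    then have "\<sigma> (a + x * poly p x) = \<sigma> a + \<sigma> x * \<sigma> (poly p x)"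
      using K(2) x unfolding field_aut_C_def by (simp add: mult_closed)
    then show ?case using pCons.IH fa fp \<open>p \<in> polys_over K\<close> by simp
  qed
qed

text \<open>The base F stays arbitrary because two bases are compared: the splitting field of the
  graph and the rationals.\<close>

locale cyclotomic_extension = complex_subfield F for F +
  fixes n :: nat and m :: "complex poly"
  assumes n_pos: "0 < n"
    and sub: "F \<subseteq> cyclotomic_field n"
    and minpoly: "is_minpoly F (zeta n) m"
begin

abbreviation "K \<equiv> cyclotomic_field n"
abbreviation "\<zeta> \<equiv> zeta n"

text \<open>The image of Gal(K/F) under eta, described through roots of m so that it makes sense
  before any automorphism has been constructed.\<close>

definition galois_exponents :: "nat set" where
  "galois_exponents = {h \<in> units_mod n. poly m (\<zeta> ^ h) = 0}"

lemma K_eq_adjoin: "K = adjoin F \<zeta>"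
  unfolding cyclotomic_field_def
  by (rule gen_field_singleton_eq_adjoin[OF subfield _ minpoly]) (use sub in \<open>simp add: cyclotomic_field_def\<close>)

lemma m_dvd: "m dvd monom 1 n - 1"
  by (rule minpoly_dvd[OF minpoly]) (use n_pos in \<open>auto simp: poly_monom\<close>)

text \<open>Conjugates of \<zeta> are primitive roots of unity: with k = n / gcd(h, n) the conjugate
  satisfies X^k = 1, so m divides X^k - 1 and \<zeta> satisfies it too, which forces k = n.\<close>

lemma coprime_root:
  assumes "poly m (\<zeta> ^ h) = 0"
  shows "coprime h n"
proof -
  define d where "d = gcd h n"
  define k where "k = n div d"
  have d: "d dvd h" "d dvd n" "0 < d" using n_pos by (auto simp: d_def)
  have "h * k = n * (h div d)" using d by (simp add: k_def div_mult_swap mult.commute)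
  then have "(\<zeta> ^ h) ^ k = 1" using n_pos by (simp add: power_mult[symmetric] zeta_power_eq_1_iff)
  then have "m dvd monom 1 k - 1"
    by (intro minpoly_dvd[OF minpoly_conjugate[OF minpoly assms]]) (auto simp: poly_monom)
  then have "poly (monom 1 k - 1) \<zeta> = 0"
    by (rule poly_zero_of_dvd) (use minpoly in \<open>simp add: is_minpoly_def\<close>)
  then have "n dvd k" using n_pos by (simp add: poly_monom zeta_power_eq_1_iff)
  moreover have "0 < k" using d n_pos by (auto simp: k_def dvd_imp_le)
  ultimately have "n \<le> n div d" by (auto simp: k_def dest: dvd_imp_le)
  then have "d = 1" using n_pos d(3) by (metis div_less_dividend le_antisym linorder_not_le less_one nat_neq_iff)
  then show ?thesis by (simp add: d_def coprime_iff_gcd_eq_1)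
qed

lemma bij_betw_galois_exponents:
  "bij_betw (\<lambda>h. \<zeta> ^ h) galois_exponents {z. poly m z = 0}"
proof (rule bij_betw_imageI)
  show "inj_on (\<lambda>h. \<zeta> ^ h) galois_exponents"
    using bij_betw_zeta_power[OF n_pos] unfolding bij_betw_def
    by (auto simp: galois_exponents_def units_mod_def inj_on_def)
  show "(\<lambda>h. \<zeta> ^ h) ` galois_exponents = {z. poly m z = 0}"
  proof safe
    fix z assume z: "poly m z = 0"
    then have "poly (monom 1 n - 1) z = 0" using poly_zero_of_dvd[OF m_dvd] by blast
    then have "z \<in> {z. z ^ n = 1}" by (simp add: poly_monom)
    then obtain h where "h < n" "z = \<zeta> ^ h"
      using bij_betw_zeta_power[OF n_pos] unfolding bij_betw_def by blast
    then show "z \<in> (\<lambda>h. \<zeta> ^ h) ` galois_exponents"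
      using z coprime_root by (auto simp: galois_exponents_def units_mod_def)
  qed (auto simp: galois_exponents_def)
qed

text \<open>Separability by counting: X^n - 1 = m q has n distinct roots, while m and q contribute
  at most deg m + deg q = n, so neither bound can be strict.\<close>

lemma card_roots_m: "card {z. poly m z = 0} = degree m"
proof -
  obtain q where q: "monom 1 n - 1 = m * q" using m_dvd by (auto elim: dvdE)
  have deg: "degree (monom 1 n - 1 :: complex poly) = n"
    using n_pos degree_add_eq_left[of "- 1" "monom 1 n :: complex poly"] by (simp add: degree_monom_eq)
  have ne: "m \<noteq> 0" "q \<noteq> 0" using q deg n_pos by auto
  have "{z. z ^ n = 1} = {z. poly m z = 0} \<union> {z. poly q z = 0}"
    using arg_cong[OF q, of "\<lambda>p. poly p _ = 0"] by (auto simp: poly_monom)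
  then have "n \<le> card {z. poly m z = 0} + card {z. poly q z = 0}"
    using card_roots_unity_eq[OF n_pos] by (metis card_Un_le)
  moreover have "card {z. poly m z = 0} \<le> degree m" "card {z. poly q z = 0} \<le> degree q"
    using ne by (auto intro: card_poly_roots_bound)
  moreover have "n = degree m + degree q" using deg q ne by (simp add: degree_mult_eq)
  ultimately show ?thesis by simp
qed

lemma card_galois_exponents: "card galois_exponents = degree m"
  using bij_betw_same_card[OF bij_betw_galois_exponents] card_roots_m by simp

lemma poly_conjugate_cong:
  assumes "p \<in> polys_over F" "q \<in> polys_over F" "poly p \<zeta> = poly q \<zeta>" "poly m y = 0"
  shows "poly p y = poly q y"
proof -
  have "m dvd p - q" by (rule minpoly_dvd[OF minpoly]) (use assms in auto)
  then have "poly (p - q) y = 0" using assms(4) by (rule poly_zero_of_dvd)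
  then show ?thesis by simp
qed

lemma galois_automorphism:
  assumes h: "h \<in> galois_exponents"
  obtains \<sigma> where "field_aut_C K \<sigma>" "\<And>p. p \<in> polys_over F \<Longrightarrow> \<sigma> (poly p \<zeta>) = poly p (\<zeta> ^ h)"
proof -
  have root: "poly m (\<zeta> ^ h) = 0" and cop: "coprime h n"
    using h by (auto simp: galois_exponents_def units_mod_def)
  \<comment> \<open>The value does not depend on the chosen representative of x, by
    \<open>poly_conjugate_cong\<close>.\<close>
  define \<sigma> where "\<sigma> x = poly (SOME p. p \<in> polys_over F \<and> poly p \<zeta> = x) (\<zeta> ^ h)" for x
  have eval: "\<sigma> (poly p \<zeta>) = poly p (\<zeta> ^ h)" if "p \<in> polys_over F" for p
  proof -
    have "(SOME q. q \<in> polys_over F \<and> poly q \<zeta> = poly p \<zeta>) \<in> polys_over F \<and>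
      poly (SOME q. q \<in> polys_over F \<and> poly q \<zeta> = poly p \<zeta>) \<zeta> = poly p \<zeta>"
      by (rule someI[of _ p]) (use that in auto)
    then show ?thesis unfolding \<sigma>_def using poly_conjugate_cong[OF _ that _ root] by blast
  qed
  have K: "x \<in> K \<longleftrightarrow> (\<exists>p\<in>polys_over F. x = poly p \<zeta>)" for x
    by (auto simp: K_eq_adjoin adjoin_def)
  have hom: "\<sigma> (x + y) = \<sigma> x + \<sigma> y \<and> \<sigma> (x * y) = \<sigma> x * \<sigma> y" if xy: "x \<in> K" "y \<in> K" for x y
  proof -
    obtain p q where p: "p \<in> polys_over F" "x = poly p \<zeta>" "q \<in> polys_over F" "y = poly q \<zeta>"
      using xy K by auto
    have "\<sigma> (poly (p + q) \<zeta>) = poly (p + q) (\<zeta> ^ h)" "\<sigma> (poly (p * q) \<zeta>) = poly (p * q) (\<zeta> ^ h)"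
      by (rule eval, use p in blast)+
    then show ?thesis using p eval[of p] eval[of q] unfolding poly_add poly_mult by metis
  qed
  have one: "\<sigma> 1 = 1" using eval[of 1] by simp
  interpret KF: complex_subfield K
    by standard (simp add: cyclotomic_field_def subfield_gen_field)
  have "bij_betw \<sigma> K K"
  proof (rule bij_betw_imageI)
    show "inj_on \<sigma> K"
    proof (rule inj_onI, rule ccontr)
      fix x y assume xy: "x \<in> K" "y \<in> K" "\<sigma> x = \<sigma> y" "x \<noteq> y"
      \<comment> \<open>A nonzero difference is invertible in K; were it sent to 0, so would 1
        be.\<close>
      have mem: "x - y \<in> K" "inverse (x - y) \<in> K" using xy by auto
      have "\<sigma> x = \<sigma> ((x - y) + y)" by simp
      also have "\<dots> = \<sigma> (x - y) + \<sigma> y" using hom mem xy by blast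
      finally have "\<sigma> (x - y) = 0" using xy by simp
      moreover have "\<sigma> ((x - y) * inverse (x - y)) = \<sigma> (x - y) * \<sigma> (inverse (x - y))"
        using hom mem by blast
      ultimately show False using xy(4) one by simp
    qed
    show "\<sigma> ` K = K"
    proof
      have "\<zeta> ^ h \<in> K" using gen_field_contains[of "{\<zeta>}"] by (auto simp: cyclotomic_field_def[symmetric])
      then have "poly p (\<zeta> ^ h) \<in> K" if "p \<in> polys_over F" for p
        using that sub by (intro KF.poly_closed) (auto simp: polys_over_def)
      then show "\<sigma> ` K \<subseteq> K" using eval K by force
      obtain h' where "[h * h' = 1] (mod n)" using cop cong_solve_coprime_nat by auto
      then have h': "\<zeta> ^ (h * h') = \<zeta>" using zeta_power_eq_iff[OF n_pos, of "h * h'" 1] by simp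
      show "K \<subseteq> \<sigma> ` K"
      proof
        fix x assume "x \<in> K"
        then obtain p where p: "p \<in> polys_over F" "x = poly p \<zeta>" using K by auto
        \<comment> \<open>With h' inverse to h modulo n, p(\<zeta>^h') is a preimage of
          p(\<zeta>).\<close>
        let ?q = "pcompose p (monom 1 h')"
        have q: "?q \<in> polys_over F" using p by auto
        have "\<sigma> (poly ?q \<zeta>) = x"
          unfolding eval[OF q] using h' p(2) by (simp add: poly_pcompose poly_monom power_mult[symmetric])
        then show "x \<in> \<sigma> ` K" using q K by blast
      qed
    qed
  qed
  with hom one have "field_aut_C K \<sigma>" unfolding field_aut_C_def by blast
  then show ?thesis using that eval by blast
qed

text \<open>The reduced representative r has degree below deg m but takes a single value at the deg
  m conjugates of \<zeta>, so it is constant, and its only coefficient lies in F.\<close>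

lemma fixed_by_all_conjugations:
  assumes p: "p \<in> polys_over F" and fixd: "\<And>h. h \<in> galois_exponents \<Longrightarrow> poly p (\<zeta> ^ h) = poly p \<zeta>"
  shows "poly p \<zeta> \<in> F"
proof -
  obtain r where r: "r \<in> polys_over F" "r = 0 \<or> degree r < degree m" "poly p \<zeta> = poly r \<zeta>"
    using adjoin_eq_reduced[OF minpoly, of "poly p \<zeta>"] p by (auto simp: adjoin_def)
  \<comment> \<open>The constant subtracted is not yet known to lie in F, so
    \<open>minpoly_dvd\<close> cannot be applied to \<open>s\<close>; roots are counted
    instead.\<close>
  define s where "s = r - [:poly p \<zeta>:]"
  have "{z. poly m z = 0} \<subseteq> {z. poly s z = 0}"
  proof safe
    fix z assume z: "poly m z = 0"
    then obtain h where "h \<in> galois_exponents" "z = \<zeta> ^ h"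
      using bij_betw_galois_exponents unfolding bij_betw_def by blast
    then have "poly p z = poly p \<zeta>" using fixd by simp
    moreover have "poly p z = poly r z" by (rule poly_conjugate_cong[OF p r(1,3) z])
    ultimately show "poly s z = 0" by (simp add: s_def)
  qed
  then have le: "degree m \<le> card {z. poly s z = 0}" if "s \<noteq> 0"
    using card_roots_m that by (metis card_mono poly_roots_finite)
  have "degree s < degree m"
    using r(2) degree_minpoly_pos[OF minpoly] unfolding s_def
    by (intro degree_diff_less) auto
  then have "s = 0" using le card_poly_roots_bound[of s] by fastforce
  then have "r = [:poly p \<zeta>:]" by (simp add: s_def)
  then show ?thesis using r(1) by (metis pCons_polys_over)
qed

lemma rat_degree_cyclotomic_field: "rat_degree K = rat_degree F * card galois_exponents"
  unfolding K_eq_adjoin card_galois_exponents by (rule rat_degree_adjoin[OF minpoly])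

end

lemma cyclotomic_minpoly_exists:
  assumes "subfield_C F" "0 < n"
  shows "\<exists>m. is_minpoly F (zeta n) m"
proof -
  interpret complex_subfield F by standard (rule assms)
  have "coeff (monom 1 n - 1 :: complex poly) n \<noteq> 0" using assms(2) by simp
  then have "monom 1 n - 1 \<noteq> (0 :: complex poly)" by force
  then show ?thesis by (intro minpoly_exists[of "monom 1 n - 1"]) (use assms in \<open>auto simp: poly_monom\<close>)
qed

section \<open>Irreducibility of the cyclotomic polynomial\<close>

text \<open>All inner binomial coefficients are divisible by q. The ring is arbitrary because both
  integers and integer polynomials are needed.\<close>

lemma prime_dvd_power_add:
  fixes a b :: "'a :: comm_ring_1"
  assumes q: "prime q"
  shows "of_nat q dvd (a + b) ^ q - (a ^ q + b ^ q)"
proof -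
  let ?t = "\<lambda>k. of_nat (q choose k) * a ^ k * b ^ (q - k)"
  have q0: "0 < q" using q by (rule prime_gt_0_nat)
  have set: "{..q} = insert 0 (insert q {0<..<q})" using q0 by auto
  have "(a + b) ^ q = (\<Sum>k\<le>q. ?t k)" by (rule binomial_ring)
  also have "\<dots> = (a ^ q + b ^ q) + (\<Sum>k\<in>{0<..<q}. ?t k)"
    unfolding set using q0 by (simp add: algebra_simps)
  finally have "(a + b) ^ q - (a ^ q + b ^ q) = (\<Sum>k\<in>{0<..<q}. ?t k)" by simp
  also have "of_nat q dvd \<dots>"
  proof (rule dvd_sum)
    fix k assume "k \<in> {0<..<q}"
    then have "q dvd q choose k" using q by (intro dvd_choose_prime) auto
    then have "(of_nat q :: 'a) dvd of_nat (q choose k)" by (metis dvd_def of_nat_mult)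
    then show "of_nat q dvd ?t k" by (simp add: mult.assoc)
  qed
  finally show ?thesis .
qed

text \<open>Fermat's little theorem, carried from 0 in both directions by the binomial
  congruence.\<close>

lemma prime_dvd_power_diff_self:
  assumes q: "prime q"
  shows "int q dvd a ^ q - a"
proof (induction a rule: int_induct[where k = 0])
  case base
  then show ?case using prime_gt_0_nat[OF q] by (simp add: zero_power)
next
  case (step1 i)
  have "(i + 1) ^ q - (i + 1) = ((i + 1) ^ q - (i ^ q + 1 ^ q)) + (i ^ q - i)" by simp
  moreover have "int q dvd (i + 1) ^ q - (i ^ q + 1 ^ q)"
    using prime_dvd_power_add[OF q, of i 1] by simp
  ultimately show ?case using step1 by (metis dvd_add)
next
  case (step2 i)
  have "(i - 1) ^ q - (i - 1) = (i ^ q - i) - (i ^ q - ((i - 1) ^ q + 1 ^ q))" by simp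
  moreover have "int q dvd i ^ q - ((i - 1) ^ q + 1 ^ q)"
    using prime_dvd_power_add[OF q, of "i - 1" 1] by simp
  ultimately show ?case using step2 by (metis dvd_diff)
qed

lemma prime_dvd_poly_frobenius:
  fixes p :: "int poly"
  assumes q: "prime q"
  shows "of_nat q dvd p ^ q - pcompose p (monom 1 q)"
proof (induction p)
  case 0
  then show ?case using prime_gt_0_nat[OF q] by (simp add: zero_power)
next
  case (pCons a p)
  let ?X = "[:0, 1:] :: int poly"
  have split: "pCons a p = [:a:] + ?X * p" by simp
  have X: "?X ^ q = monom 1 q" by (simp add: monom_altdef)
  \<comment> \<open>Three multiples of q: the mixed binomial terms, Fermat's difference for the
    constant coefficient, and X^q times the induction hypothesis.\<close>
  have "pCons a p ^ q - pcompose (pCons a p) (monom 1 q) =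
    ((([:a:] + ?X * p) ^ q - ([:a:] ^ q + (?X * p) ^ q)) + ([:a:] ^ q - [:a:]))
      + monom 1 q * (p ^ q - pcompose p (monom 1 q))"
    unfolding pcompose_pCons power_mult_distrib X by (simp add: algebra_simps)
  moreover have "of_nat q dvd ([:a:] + ?X * p) ^ q - ([:a:] ^ q + (?X * p) ^ q)"
    by (rule prime_dvd_power_add[OF q])
  moreover have "of_nat q dvd [:a:] ^ q - [:a:]"
  proof -
    obtain c where c: "a ^ q - a = int q * c" using prime_dvd_power_diff_self[OF q] by (auto elim: dvdE)
    have "[:a:] ^ q - [:a:] = [:a ^ q - a:]" by (simp add: poly_const_pow)
    also have "\<dots> = of_nat q * [:c:]" using c by (simp add: of_nat_poly)
    finally show ?thesis by (rule dvdI)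
  qed
  ultimately show ?case using pCons.IH by (metis dvd_add dvd_mult)
qed

section \<open>Values of integer polynomials at roots of unity\<close>

abbreviation int_eval :: "int poly \<Rightarrow> complex \<Rightarrow> complex" where
  "int_eval p x \<equiv> poly (map_poly of_int p) x"

lemma int_eval_hom:
  "int_eval (p + q) x = int_eval p x + int_eval q x"
  "int_eval (p - q) x = int_eval p x - int_eval q x"
  "int_eval (p * q) x = int_eval p x * int_eval q x"
  "int_eval (p ^ k) x = int_eval p x ^ k"
  "int_eval (monom 1 k) x = x ^ k"
  by (simp_all add: of_int_poly_hom.hom_add of_int_poly_hom.hom_minus of_int_poly_hom.hom_mult
      of_int_poly_hom.hom_power map_poly_monom poly_monom)

lemma int_eval_of_nat: "int_eval (of_nat k) x = of_nat k"
  by (induction k) (simp_all add: int_eval_hom)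

lemma int_eval_pcompose: "int_eval (pcompose p q) x = int_eval p (int_eval q x)"
  by (induction p) (simp_all add: pcompose_pCons int_eval_hom of_int_hom.map_poly_pCons_hom)

lemma int_eval_frobenius:
  assumes "prime q"
  obtains r where "\<And>x. int_eval p (x ^ q) = int_eval p x ^ q - of_nat q * int_eval r x"
proof -
  obtain r where "p ^ q - pcompose p (monom 1 q) = of_nat q * r"
    using prime_dvd_poly_frobenius[OF assms] by (auto elim: dvdE)
  then have "pcompose p (monom 1 q) = p ^ q - of_nat q * r" by (simp add: algebra_simps)
  from arg_cong[OF this, of "\<lambda>p. int_eval p _"]
  show ?thesis by (intro that[of r]) (simp add: int_eval_pcompose int_eval_hom poly_monom int_eval_of_nat)
qed

text \<open>Multiplication by the value on the powers of \<open>x\<close> is given by an integer circulant matrix.\<close>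
lemma algebraic_int_int_eval:
  assumes n: "0 < n" and x: "x ^ n = 1"
  shows "algebraic_int (int_eval r x)"
proof -
  define A :: "int mat" where
    "A = mat n n (\<lambda>(i, j). \<Sum>k\<in>{k. k \<le> degree r \<and> (k + i) mod n = j}. coeff r k)"
  let ?A = "map_mat complex_of_int A"
  let ?v = "vec n (\<lambda>j. x ^ j)"
  have A: "A \<in> carrier_mat n n" "?A \<in> carrier_mat n n" by (auto simp: A_def)
  have xmod: "x ^ (k mod n) = x ^ k" for k
  proof -
    have "x ^ k = x ^ (n * (k div n) + k mod n)" by simp
    also have "\<dots> = x ^ (k mod n)" unfolding power_add power_mult x by simp
    finally show ?thesis by simp
  qed
  have "?A *\<^sub>v ?v = int_eval r x \<cdot>\<^sub>v ?v"
  proof (rule eq_vecI)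
    fix i assume "i < dim_vec (int_eval r x \<cdot>\<^sub>v ?v)"
    then have i: "i < n" by simp
    have "(?A *\<^sub>v ?v) $ i =
      (\<Sum>j<n. of_int (\<Sum>k\<in>{k. k \<le> degree r \<and> (k + i) mod n = j}. coeff r k) * x ^ j)"
      using i A by (simp add: scalar_prod_def A_def atLeast0LessThan)
    also have "\<dots> = (\<Sum>j<n. \<Sum>k\<in>{k. k \<in> {..degree r} \<and> (k + i) mod n = j}. of_int (coeff r k) * x ^ (k + i))"
      by (auto simp: sum_distrib_right xmod[symmetric, of "_ + i"] intro!: sum.cong)
    also have "\<dots> = (\<Sum>k\<in>{..degree r}. of_int (coeff r k) * x ^ (k + i))"
      using n by (intro sum.group) auto
    also have "\<dots> = int_eval r x * x ^ i"
      by (simp add: poly_altdef sum_distrib_right power_add mult.assoc)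
    finally show "(?A *\<^sub>v ?v) $ i = (int_eval r x \<cdot>\<^sub>v ?v) $ i" using i by simp
  qed (use A in simp)
  moreover have "?v \<noteq> 0\<^sub>v n"
  proof
    assume "?v = 0\<^sub>v n"
    then have "?v $ 0 = 0\<^sub>v n $ 0" by simp
    then show False using n by simp
  qed
  ultimately have "eigenvalue ?A (int_eval r x)"
    unfolding eigenvalue_def eigenvector_def using A by (intro exI[of _ ?v]) auto
  \<comment> \<open>The characteristic polynomial of an integer matrix is monic with integer
    coefficients and vanishes at every eigenvalue.\<close>
  then have "int_eval (char_poly A) (int_eval r x) = 0"
    using eigenvalue_root_char_poly[OF A(2)] of_int_hom.char_poly_hom[OF A(1)] by metis
  moreover have "lead_coeff (char_poly A) = 1" using degree_monic_char_poly[OF A(1)] by simp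
  ultimately show ?thesis unfolding algebraic_int_altdef_ipoly by blast
qed

lemma subfield_Rats: "subfield_C \<rat>"
  unfolding subfield_C_def by auto

lemma clear_denominators:
  assumes "p \<in> polys_over \<rat>"
  shows "\<exists>N>0. \<exists>s. Polynomial.smult (of_nat N) p = map_poly of_int s"
proof -
  interpret complex_subfield \<rat> by standard (rule subfield_Rats)
  show ?thesis using assms
  proof (induction p)
    case 0
    then show ?case by (intro exI[of _ 1] conjI exI[of _ 0]) auto
  next
    case (pCons a p)
    then obtain N s where N: "N > 0" "Polynomial.smult (of_nat N) p = map_poly of_int s" by auto
    from pCons.prems obtain u v where uv: "v > 0" "a = of_int u / of_int v"
      by (auto elim: Rats_cases')
    have "Polynomial.smult (of_nat (N * nat v)) (pCons a p) = map_poly of_int (pCons (int N * u) (Polynomial.smult v s))"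
      using uv by (simp add: of_int_hom.map_poly_pCons_hom of_int_hom.map_poly_hom_smult N(2)[symmetric] mult_ac)
    then show ?case using N(1) uv(1) by (intro exI[of _ "N * nat v"]) auto
  qed
qed

text \<open>A substitute for the norm: a nonzero value divides a positive integer in Z[zeta], which
  will bound the primes q that can divide it.\<close>

lemma nonzero_dvd_int:
  assumes n: "0 < n" and \<alpha>: "int_eval p (zeta n ^ i) \<noteq> 0"
  shows "\<exists>N>0. \<exists>s. of_nat N = int_eval p (zeta n ^ i) * int_eval s (zeta n)"
proof -
  interpret Q: complex_subfield \<rat> by standard (rule subfield_Rats)
  obtain m where m: "is_minpoly \<rat> (zeta n) m"
    using cyclotomic_minpoly_exists[OF subfield_Rats n] by blast
  interpret K: complex_subfield "adjoin \<rat> (zeta n)" by standard (rule Q.subfield_adjoin[OF m])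
  have "int_eval p (zeta n ^ i) \<in> adjoin \<rat> (zeta n)"
    by (intro K.poly_closed K.power_closed Q.self_in_adjoin) (auto simp: polys_over_def coeff_map_poly)
  then have "inverse (int_eval p (zeta n ^ i)) \<in> adjoin \<rat> (zeta n)" by blast
  then obtain r where r: "r \<in> polys_over \<rat>" "inverse (int_eval p (zeta n ^ i)) = poly r (zeta n)"
    by (auto simp: adjoin_def)
  from clear_denominators[OF r(1)] obtain N s where
    N: "N > 0" "Polynomial.smult (of_nat N) r = map_poly of_int s" by blast
  have "int_eval s (zeta n) = of_nat N * inverse (int_eval p (zeta n ^ i))"
    unfolding N(2)[symmetric] r(2) by simp
  then have "of_nat N = int_eval p (zeta n ^ i) * int_eval s (zeta n)" using \<alpha> by simp
  then show ?thesis using N(1) by blast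
qed

text \<open>If p vanishes at zeta^j, the Frobenius congruence makes p(zeta^(jq)) a multiple of q in
  Z[zeta]. If it is nonzero it also divides some \<open>N i\<close>, so \<open>N i\<close> / q is a
  rational algebraic integer, hence an integer, and q is at most \<open>N i\<close>.\<close>

lemma root_conjugate_large_prime:
  fixes p :: "int poly"
  assumes n: "0 < n"
  obtains B where "\<And>q j. prime q \<Longrightarrow> B < q \<Longrightarrow> int_eval p (zeta n ^ j) = 0 \<Longrightarrow>
    int_eval p (zeta n ^ (j * q)) = 0"
proof -
  have "\<exists>N. N > 0 \<and> (int_eval p (zeta n ^ i) \<noteq> 0 \<longrightarrow>
      (\<exists>s. of_nat N = int_eval p (zeta n ^ i) * int_eval s (zeta n)))" for i
    using nonzero_dvd_int[OF n, of p i] by blast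
  then obtain N where N: "\<And>i. N i > (0::nat)"
    "\<And>i. int_eval p (zeta n ^ i) \<noteq> 0 \<Longrightarrow> \<exists>s. of_nat (N i) = int_eval p (zeta n ^ i) * int_eval s (zeta n)"
    by metis
  have "int_eval p (zeta n ^ (j * q)) = 0"
    if q: "prime q" and B: "(\<Sum>i<n. N i) < q" and j: "int_eval p (zeta n ^ j) = 0" for q j
  proof (rule ccontr)
    assume ne: "int_eval p (zeta n ^ (j * q)) \<noteq> 0"
    \<comment> \<open>Only residues modulo n matter, so the finitely many numbers \<open>N i\<close>
      with i < n give one bound for all j and q.\<close>
    define i where "i = (j * q) mod n"
    have i: "zeta n ^ i = zeta n ^ (j * q)" by (simp add: i_def zeta_power_mod)
    obtain s where s: "of_nat (N i) = int_eval p (zeta n ^ i) * int_eval s (zeta n)"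
      using N(2)[of i] ne i by auto
    obtain r where r: "\<And>x. int_eval p (x ^ q) = int_eval p x ^ q - of_nat q * int_eval r x"
      using int_eval_frobenius[OF q] by blast
    have "int_eval p (zeta n ^ i) = - of_nat q * int_eval r (zeta n ^ j)"
      using r[of "zeta n ^ j"] j prime_gt_0_nat[OF q] by (simp add: i power_mult)
    also have "int_eval r (zeta n ^ j) = int_eval (pcompose r (monom 1 j)) (zeta n)"
      by (simp add: int_eval_pcompose int_eval_hom poly_monom)
    finally have "of_nat (N i) = - of_nat q * int_eval (pcompose r (monom 1 j) * s) (zeta n)"
      using s by (simp add: int_eval_hom)
    then have quot: "int_eval (pcompose r (monom 1 j) * s) (zeta n) = - of_nat (N i) / of_nat q"
      using prime_gt_0_nat[OF q] by (simp add: field_simps)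
    have "algebraic_int (- of_nat (N i) / of_nat q :: complex)"
      unfolding quot[symmetric] by (rule algebraic_int_int_eval[OF n]) (use n in simp)
    then have "(- of_nat (N i) / of_nat q :: complex) \<in> \<int>"
      by (rule rational_algebraic_int_is_int) auto
    then obtain z where "(- of_nat (N i) / of_nat q :: complex) = of_int z" by (rule Ints_cases)
    then have "- (of_nat (N i) :: complex) = of_nat q * of_int z"
      using prime_gt_0_nat[OF q] by (simp add: field_simps)
    then have "(of_nat (N i) :: complex) = - of_nat q * of_int z"
      by (metis minus_minus mult_minus_left)
    then have "complex_of_int (int (N i)) = complex_of_int (- int q * z)" by simp
    then have "int (N i) = - int q * z" by (simp only: of_int_eq_iff)
    then have "int q dvd int (N i)" by simp
    then have "q \<le> N i" using N(1)[of i] by (simp add: dvd_imp_le)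
    also have "\<dots> \<le> (\<Sum>i<n. N i)" using n by (intro member_le_sum) (auto simp: i_def)
    finally show False using B by simp
  qed
  then show ?thesis using that by blast
qed

text \<open>Take h + n t with t the product of the primes up to B that do not divide h. Such a prime
  divides n t but not h; a prime dividing h divides neither n nor t. Thus no prime up to B divides
  the sum.\<close>

lemma large_prime_factors_representative:
  fixes h n B :: nat
  assumes n: "0 < n" and cop: "coprime h n"
  obtains h' where "[h' = h] (mod n)" "0 < h'" "\<And>q. prime q \<Longrightarrow> q dvd h' \<Longrightarrow> B < q"
proof -
  let ?P = "{q. prime q \<and> q \<le> B \<and> \<not> q dvd h}"
  define t where "t = \<Prod>?P"
  have fin: "finite ?P" by (rule finite_subset[of _ "{..B}"]) auto
  have t0: "0 < t" unfolding t_def using prime_gt_0_nat by (intro prod_pos) auto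
  have big: "B < q" if q: "prime q" "q dvd h + n * t" for q
  proof (rule ccontr)
    assume "\<not> B < q"
    then have le: "q \<le> B" by simp
    show False
    proof (cases "q dvd h")
      case True
      then have "q dvd n * t" using q(2) by (simp add: dvd_add_right_iff)
      moreover have "\<not> q dvd n" using True cop q(1) by (meson coprime_common_divisor not_prime_unit)
      ultimately have "q dvd t" using q(1) by (simp add: prime_dvd_mult_iff)
      then obtain q' where "q' \<in> ?P" "q dvd q'"
        unfolding t_def using q(1) fin by (auto simp: prime_dvd_prod_iff)
      then show False using True q(1) by (auto dest: primes_dvd_imp_eq)
    next
      case False
      then have "q dvd t" unfolding t_def using fin q(1) le by (intro dvd_prodI) auto
      then show False using q(2) False by (simp add: dvd_add_left_iff)
    qed
  qed
  show ?thesis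
  proof (rule that)
    show "[h + n * t = h] (mod n)" by (simp add: cong_def)
    show "0 < h + n * t" using n t0 by simp
  qed (rule big)
qed

text \<open>Equivalent to the irreducibility of the cyclotomic polynomial. The Frobenius congruence
  \<open>p(x)^q = p(x^q)\<close> mod \<open>q\<close> settles exponents that are large primes, and every residue class
  coprime to \<open>n\<close> contains a product of large primes.\<close>
lemma root_conjugate:
  assumes n: "0 < n" and cop: "coprime h n" and p: "p \<in> polys_over \<rat>" "poly p (zeta n) = 0"
  shows "poly p (zeta n ^ h) = 0"
proof -
  obtain N s where N: "N > 0" "Polynomial.smult (of_nat N) p = map_poly of_int s"
    using clear_denominators[OF p(1)] by blast
  have s: "int_eval s x = 0 \<longleftrightarrow> poly p x = 0" for x unfolding N(2)[symmetric] using N(1) by simp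
  obtain B where B: "\<And>q j. prime q \<Longrightarrow> B < q \<Longrightarrow> int_eval s (zeta n ^ j) = 0 \<Longrightarrow>
    int_eval s (zeta n ^ (j * q)) = 0"
    using root_conjugate_large_prime[OF n] by blast
  \<comment> \<open>The prime factors of k are transferred to the exponent one at a time, so the
    starting exponent j has to vary.\<close>
  have step: "int_eval s (zeta n ^ (j * k)) = 0"
    if "int_eval s (zeta n ^ j) = 0" "0 < k" "\<And>q. prime q \<Longrightarrow> q dvd k \<Longrightarrow> B < q" for j k
    using that
  proof (induction k arbitrary: j rule: less_induct)
    case (less k)
    show ?case
    proof (cases "k = 1")
      case False
      then obtain q where q: "prime q" "q dvd k" using prime_factor_nat by blast
      then obtain k' where k': "k = q * k'" by (auto elim: dvdE)
      have "int_eval s (zeta n ^ (j * q)) = 0" using B less.prems q by blast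
      moreover have "k' < k" "0 < k'" using k' less.prems(2) prime_gt_1_nat[OF q(1)] by auto
      ultimately have "int_eval s (zeta n ^ (j * q * k')) = 0"
        using less.IH[of k' "j * q"] less.prems(3) k' by auto
      then show ?thesis by (simp add: k' mult.assoc)
    qed (use less in simp)
  qed
  obtain h' where h': "[h' = h] (mod n)" "0 < h'" "\<And>q. prime q \<Longrightarrow> q dvd h' \<Longrightarrow> B < q"
    using large_prime_factors_representative[OF n cop] by blast
  have "int_eval s (zeta n ^ (1 * h')) = 0" by (rule step) (use h' s p in auto)
  moreover have "zeta n ^ h' = zeta n ^ h" using h'(1) zeta_power_eq_iff[OF n] by blast
  ultimately show ?thesis by (simp add: s)
qed

section \<open>The group algebra\<close>

text \<open>Gaussian elimination of one coordinate with a pivot vector. The relation is indexed by I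
  and not by the vectors themselves, so coinciding powers of a group algebra element cause no
  trouble.\<close>

lemma nontrivial_relation:
  fixes v :: "'i \<Rightarrow> 'x \<Rightarrow> 'f :: field"
  assumes "finite X" "finite I" "card X < card I"
  shows "\<exists>c. (\<exists>i\<in>I. c i \<noteq> 0) \<and> (\<forall>x\<in>X. (\<Sum>i\<in>I. c i * v i x) = 0)"
  using assms
proof (induction X arbitrary: I v rule: finite_induct)
  case empty
  then have "I \<noteq> {}" by auto
  then show ?case by (intro exI[of _ "\<lambda>_. 1"]) auto
next
  case (insert x X)
  show ?case
  proof (cases "\<forall>i\<in>I. v i x = 0")
    case True
    obtain c where "\<exists>i\<in>I. c i \<noteq> 0" "\<forall>x\<in>X. (\<Sum>i\<in>I. c i * v i x) = 0"
      using insert.IH[of I v] insert.prems insert.hyps by auto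
    then show ?thesis using True by (intro exI[of _ c]) auto
  next
    case False
    then obtain k where k: "k \<in> I" "v k x \<noteq> 0" by auto
    define w where "w i y = v i y - v i x / v k x * v k y" for i y
    have "card X < card (I - {k})" using insert k by simp
    then obtain c where c: "\<exists>i\<in>I - {k}. c i \<noteq> 0" "\<forall>y\<in>X. (\<Sum>i\<in>I - {k}. c i * w i y) = 0"
      using insert.IH[of "I - {k}" w] insert.prems by auto
    \<comment> \<open>The pivot receives the coefficient that undoes the subtraction made in
      \<open>w\<close>.\<close>
    define d where "d = c(k := - (\<Sum>i\<in>I - {k}. c i * (v i x / v k x)))"
    have "(\<Sum>i\<in>I. d i * v i y) = (\<Sum>i\<in>I - {k}. c i * w i y)" for y
    proof -
      have "(\<Sum>i\<in>I. d i * v i y) = d k * v k y + (\<Sum>i\<in>I - {k}. d i * v i y)"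
        using k insert.prems by (simp add: sum.remove)
      also have "(\<Sum>i\<in>I - {k}. d i * v i y) = (\<Sum>i\<in>I - {k}. c i * v i y)"
        by (intro sum.cong) (auto simp: d_def)
      finally show ?thesis
        by (simp add: w_def d_def algebra_simps sum_subtractf sum_distrib_left)
    qed
    moreover have "w i x = 0" for i using k by (simp add: w_def)
    ultimately show ?thesis using c by (intro exI[of _ d]) (auto simp: d_def)
  qed
qed

text \<open>By Schur decomposition A is similar to an upper triangular B, again idempotent. Each
  diagonal entry b of B satisfies b^2 = b, so the trace is a sum of zeros and ones.\<close>

lemma trace_idempotent_rational:
  fixes A :: "complex mat"
  assumes A: "A \<in> carrier_mat n n" and idem: "A * A = A"
  shows "(\<Sum>i<n. A $$ (i, i)) \<in> \<rat>"
proof -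
  obtain es where "char_poly A = (\<Prod>a\<leftarrow>es. [:- a, 1:])" using char_poly_factorized[OF A] by blast
  from schur_decomposition_exists[OF A this] obtain B P Q where
    B: "B \<in> carrier_mat n n" "upper_triangular B" and sim: "similar_mat_wit A B P Q"
    by (auto simp: similar_mat_def)
  note w = similar_mat_witD2[OF A sim]
  have PQ: "P \<in> carrier_mat n n" "Q \<in> carrier_mat n n" "P * Q = 1\<^sub>m n" "Q * P = 1\<^sub>m n" "A = P * B * Q"
    using w by auto
  have "B = (Q * P) * B * (Q * P)" using PQ B by simp
  also have "\<dots> = Q * (P * B * Q) * P"
    using PQ(1,2) B by (simp add: assoc_mult_mat[of _ n n _ n _ n])
  also have "P * B * Q = A" using PQ(5) by simp
  finally have BQ: "B = Q * A * P" .
  have BB: "B * B = B"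
  proof -
    have "B * B = Q * (A * (P * Q) * A) * P"
      unfolding BQ using PQ(1,2) A by (simp add: assoc_mult_mat[of _ n n _ n _ n])
    also have "\<dots> = Q * A * P" using PQ(3) A idem by simp
    finally show ?thesis using BQ by simp
  qed
  have entry: "(M * N) $$ (i, i) = (\<Sum>k<n. M $$ (i, k) * N $$ (k, i))"
    if "M \<in> carrier_mat n n" "N \<in> carrier_mat n n" "i < n" for M N :: "complex mat" and i
    using that by (simp add: scalar_prod_def atLeast0LessThan)
  have BQ': "B * Q \<in> carrier_mat n n" using B PQ by simp
  have "(\<Sum>i<n. A $$ (i, i)) = (\<Sum>i<n. \<Sum>k<n. P $$ (i, k) * (B * Q) $$ (k, i))"
    using entry[OF PQ(1) BQ'] PQ B by (simp add: assoc_mult_mat[of _ n n _ n _ n])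
  also have "\<dots> = (\<Sum>k<n. \<Sum>i<n. (B * Q) $$ (k, i) * P $$ (i, k))"
    by (subst sum.swap) (simp add: mult.commute)
  also have "\<dots> = (\<Sum>k<n. (B * Q * P) $$ (k, k))"
    using entry[OF BQ' PQ(1)] by simp
  also have "B * Q * P = B" using PQ B by (simp add: assoc_mult_mat[of _ n n _ n _ n])
  finally have tr: "(\<Sum>i<n. A $$ (i, i)) = (\<Sum>k<n. B $$ (k, k))" .
  have "B $$ (i, i) \<in> \<rat>" if i: "i < n" for i
  proof -
    have "B $$ (i, i) = (\<Sum>k<n. B $$ (i, k) * B $$ (k, i))"
      using entry[OF B(1) B(1) i] BB by simp
    also have "\<dots> = (\<Sum>k\<in>{i}. B $$ (i, k) * B $$ (k, i))"
    proof (rule sum.mono_neutral_right)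
      show "\<forall>k\<in>{..<n} - {i}. B $$ (i, k) * B $$ (k, i) = 0"
      proof
        fix k assume k: "k \<in> {..<n} - {i}"
        then consider "k < i" | "i < k" by fastforce
        then show "B $$ (i, k) * B $$ (k, i) = 0"
          using upper_triangularD[OF B(2)] B(1) i k by cases auto
      qed
    qed (use i in auto)
    finally have "B $$ (i, i) * (B $$ (i, i) - 1) = 0" by (simp add: algebra_simps)
    then show ?thesis by auto
  qed
  then show ?thesis unfolding tr by (intro Rats_sum) auto
qed

section \<open>Convolution on a finite group\<close>

locale finite_group = Group.group G for G (structure) +
  assumes fin: "finite (carrier G)"
begin

lemma sum_right_mult: "a \<in> carrier G \<Longrightarrow> (\<Sum>x\<in>carrier G. F (x \<otimes> a)) = (\<Sum>x\<in>carrier G. F x)"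
  by (rule sum.reindex_bij_witness[of _ "\<lambda>x. x \<otimes> inv a" "\<lambda>x. x \<otimes> a"]) (auto simp: m_assoc)

lemma sum_left_mult: "a \<in> carrier G \<Longrightarrow> (\<Sum>x\<in>carrier G. F (a \<otimes> x)) = (\<Sum>x\<in>carrier G. F x)"
  by (rule sum.reindex_bij_witness[of _ "\<lambda>x. inv a \<otimes> x" "\<lambda>x. a \<otimes> x"]) (auto simp: m_assoc[symmetric])

text \<open>The product of the complex group algebra, ordered so that convolution by u on the left
  is the Cayley matrix of u. The default 0 off the carrier turns identities into equalities of
  functions.\<close>

definition conv :: "('a \<Rightarrow> complex) \<Rightarrow> ('a \<Rightarrow> complex) \<Rightarrow> 'a \<Rightarrow> complex" where
  "conv u v = (\<lambda>g. if g \<in> carrier G then \<Sum>h\<in>carrier G. u (g \<otimes> inv h) * v h else 0)"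

definition supported :: "('a \<Rightarrow> complex) \<Rightarrow> bool" where
  "supported u \<longleftrightarrow> (\<forall>g. g \<notin> carrier G \<longrightarrow> u g = 0)"

definition unit_mass :: "'a \<Rightarrow> complex" where
  "unit_mass g = (if g = \<one> then 1 else 0)"

lemma supported_conv [simp]: "supported (conv u v)"
  by (simp add: supported_def conv_def)

lemma supported_unit_mass [simp]: "supported unit_mass"
  by (auto simp: supported_def unit_mass_def)

lemma supported_eqI: "supported u \<Longrightarrow> supported v \<Longrightarrow> (\<And>g. g \<in> carrier G \<Longrightarrow> u g = v g) \<Longrightarrow> u = v"
  by (metis ext supported_def)

lemma conv_apply: "g \<in> carrier G \<Longrightarrow> conv u v g = (\<Sum>h\<in>carrier G. u (g \<otimes> inv h) * v h)"
  by (simp add: conv_def)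

lemma conv_one: "conv u v \<one> = (\<Sum>h\<in>carrier G. u (inv h) * v h)"
  by (simp add: conv_def)

lemma conv_assoc: "conv (conv u v) w = conv u (conv v w)"
proof (rule supported_eqI)
  fix g assume g: "g \<in> carrier G"
  have "conv (conv u v) w g = (\<Sum>h\<in>carrier G. \<Sum>k\<in>carrier G. u (g \<otimes> inv h \<otimes> inv k) * v k * w h)"
    using g by (simp add: conv_apply sum_distrib_right)
  also have "\<dots> = (\<Sum>h\<in>carrier G. \<Sum>l\<in>carrier G. u (g \<otimes> inv l) * v (l \<otimes> inv h) * w h)"
  proof (rule sum.cong[OF refl])
    fix h assume h: "h \<in> carrier G"
    have "(\<Sum>k\<in>carrier G. u (g \<otimes> inv h \<otimes> inv k) * v k * w h) =
      (\<Sum>l\<in>carrier G. u (g \<otimes> inv h \<otimes> inv (l \<otimes> inv h)) * v (l \<otimes> inv h) * w h)"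
      using sum_right_mult[of "inv h" "\<lambda>k. u (g \<otimes> inv h \<otimes> inv k) * v k * w h"] h by simp
    also have "\<dots> = (\<Sum>l\<in>carrier G. u (g \<otimes> inv l) * v (l \<otimes> inv h) * w h)"
    proof (rule sum.cong[OF refl])
      fix l assume l: "l \<in> carrier G"
      have "g \<otimes> inv h \<otimes> inv (l \<otimes> inv h) = g \<otimes> (inv h \<otimes> (h \<otimes> inv l))"
        using g h l by (simp add: inv_mult_group m_assoc)
      also have "\<dots> = g \<otimes> inv l" using g h l by (simp add: m_assoc[symmetric])
      finally show "u (g \<otimes> inv h \<otimes> inv (l \<otimes> inv h)) * v (l \<otimes> inv h) * w h =
        u (g \<otimes> inv l) * v (l \<otimes> inv h) * w h" by simp
    qed
    finally show "(\<Sum>k\<in>carrier G. u (g \<otimes> inv h \<otimes> inv k) * v k * w h) =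
      (\<Sum>l\<in>carrier G. u (g \<otimes> inv l) * v (l \<otimes> inv h) * w h)" .
  qed
  also have "\<dots> = (\<Sum>l\<in>carrier G. \<Sum>h\<in>carrier G. u (g \<otimes> inv l) * v (l \<otimes> inv h) * w h)"
    by (rule sum.swap)
  also have "\<dots> = conv u (conv v w) g" using g by (simp add: conv_apply sum_distrib_left mult.assoc)
  finally show "conv (conv u v) w g = conv u (conv v w) g" .
qed auto

lemma conv_unit_mass_left: "supported v \<Longrightarrow> conv unit_mass v = v"
proof (rule supported_eqI)
  fix g assume g: "g \<in> carrier G"
  have "conv unit_mass v g = (\<Sum>h\<in>carrier G. if h = g then v h else 0)"
    unfolding conv_apply[OF g] by (rule sum.cong) (use g in \<open>auto simp: unit_mass_def dest!: inv_equality\<close>)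
  then show "conv unit_mass v g = v g" using g fin by simp
qed auto

lemma conv_add_left: "conv (\<lambda>g. u g + u' g) v = (\<lambda>g. conv u v g + conv u' v g)"
  and conv_add_right: "conv u (\<lambda>g. v g + v' g) = (\<lambda>g. conv u v g + conv u v' g)"
  and conv_scale_left: "conv (\<lambda>g. c * u g) v = (\<lambda>g. c * conv u v g)"
  and conv_scale_right: "conv u (\<lambda>g. c * v g) = (\<lambda>g. c * conv u v g)"
  and conv_zero_left: "conv (\<lambda>_. 0) v = (\<lambda>_. 0)"
  and conv_zero_right: "conv u (\<lambda>_. 0) = (\<lambda>_. 0)"
  by (auto simp: conv_def fun_eq_iff algebra_simps sum.distrib sum_distrib_left)

lemma class_function_swap:
  assumes "class_function G u" "a \<in> carrier G" "b \<in> carrier G"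
  shows "u (a \<otimes> b) = u (b \<otimes> a)"
proof -
  have "u (b \<otimes> (a \<otimes> b) \<otimes> inv b) = u (a \<otimes> b)"
    using assms by (auto simp: class_function_def)
  moreover have "b \<otimes> (a \<otimes> b) \<otimes> inv b = b \<otimes> a" using assms by (simp add: m_assoc)
  ultimately show ?thesis by simp
qed

text \<open>Class functions are central: after substituting \<open>h = g \<otimes> inv k\<close> the
  arguments \<open>inv h \<otimes> g\<close> and \<open>g \<otimes> inv h\<close> of u are
  conjugate.\<close>

lemma conv_commute:
  assumes u: "class_function G u"
  shows "conv u v = conv v u"
proof (rule supported_eqI)
  fix g assume g: "g \<in> carrier G"
  have "conv v u g = (\<Sum>k\<in>carrier G. v (g \<otimes> inv k) * u k)" by (rule conv_apply[OF g])
  also have "\<dots> = (\<Sum>h\<in>carrier G. v h * u (inv h \<otimes> g))"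
    by (rule sum.reindex_bij_witness[of _ "\<lambda>h. inv h \<otimes> g" "\<lambda>k. g \<otimes> inv k"])
       (use g in \<open>auto simp: inv_mult_group m_assoc m_assoc[symmetric, of g "inv g"] m_assoc[symmetric, of "inv g" g]\<close>)
  also have "\<dots> = (\<Sum>h\<in>carrier G. u (g \<otimes> inv h) * v h)"
    by (rule sum.cong) (use g class_function_swap[OF u] in \<open>auto simp: mult.commute\<close>)
  finally show "conv u v g = conv v u g" by (simp add: conv_apply[OF g])
qed auto

lemma class_function_conv:
  assumes u: "class_function G u" and v: "class_function G v"
  shows "class_function G (conv u v)"
  unfolding class_function_def
proof safe
  fix g x assume gx: "g \<in> carrier G" "x \<in> carrier G"
  have "conv u v (x \<otimes> g \<otimes> inv x) = (\<Sum>h\<in>carrier G. u (x \<otimes> g \<otimes> inv x \<otimes> inv h) * v h)"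
    using gx by (simp add: conv_apply)
  also have "\<dots> = (\<Sum>k\<in>carrier G. u (x \<otimes> g \<otimes> inv x \<otimes> inv (x \<otimes> (k \<otimes> inv x))) * v (x \<otimes> (k \<otimes> inv x)))"
    using gx sum_left_mult[of x "\<lambda>h. u (x \<otimes> g \<otimes> inv x \<otimes> inv h) * v h"]
      sum_right_mult[of "inv x" "\<lambda>h. u (x \<otimes> g \<otimes> inv x \<otimes> inv (x \<otimes> h)) * v (x \<otimes> h)"] by simp
  also have "\<dots> = (\<Sum>k\<in>carrier G. u (g \<otimes> inv k) * v k)"
  proof (rule sum.cong[OF refl])
    fix k assume k: "k \<in> carrier G"
    have "inv x \<otimes> inv (x \<otimes> (k \<otimes> inv x)) = inv x \<otimes> (x \<otimes> (inv k \<otimes> inv x))"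
      using gx k by (simp add: inv_mult_group m_assoc)
    also have "\<dots> = inv k \<otimes> inv x" using gx k by (simp add: m_assoc[symmetric])
    finally have "x \<otimes> g \<otimes> inv x \<otimes> inv (x \<otimes> (k \<otimes> inv x)) = x \<otimes> (g \<otimes> inv k) \<otimes> inv x"
      using gx k by (simp add: m_assoc)
    then have "u (x \<otimes> g \<otimes> inv x \<otimes> inv (x \<otimes> (k \<otimes> inv x))) = u (g \<otimes> inv k)"
      using u gx k by (simp add: class_function_def)
    moreover have "v (x \<otimes> (k \<otimes> inv x)) = v k"
      using v gx k by (simp add: class_function_def m_assoc[symmetric])
    ultimately show "u (x \<otimes> g \<otimes> inv x \<otimes> inv (x \<otimes> (k \<otimes> inv x))) * v (x \<otimes> (k \<otimes> inv x)) =
      u (g \<otimes> inv k) * v k" by simp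
  qed
  finally show "conv u v (x \<otimes> g \<otimes> inv x) = conv u v g" using gx by (simp add: conv_apply)
qed

lemma class_function_unit_mass: "class_function G unit_mass"
  unfolding class_function_def
proof safe
  fix g x assume gx: "g \<in> carrier G" "x \<in> carrier G"
  have "x \<otimes> g \<otimes> inv x = \<one> \<longleftrightarrow> g = \<one>"
  proof
    assume "x \<otimes> g \<otimes> inv x = \<one>"
    then have "x \<otimes> g = x" using gx by (metis inv_closed inv_equality inv_inv m_closed)
    then show "g = \<one>" using gx by (metis l_cancel_one)
  qed (use gx in simp)
  then show "unit_mass (x \<otimes> g \<otimes> inv x) = unit_mass g" by (simp add: unit_mass_def)
qed

text \<open>The centre of the group algebra is reduced: with \<open>s\<close> the adjoint of \<open>u\<close> and
  \<open>y = conv s u\<close>, commutativity turns \<open>conv u u = 0\<close> into \<open>conv y y = 0\<close>, whose value at the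
  identity is the squared norm of \<open>y\<close>; in turn \<open>y \<one>\<close> is the squared norm of \<open>u\<close>.\<close>
lemma class_function_square_zero:
  assumes u: "class_function G u" and sq: "conv u u = (\<lambda>_. 0)" and g: "g \<in> carrier G"
  shows "u g = 0"
proof -
  define s where "s = (\<lambda>g. cnj (u (inv g)))"
  define y where "y = conv s u"
  have "conv y y = conv s (conv u (conv s u))" by (simp add: y_def conv_assoc)
  also have "conv u (conv s u) = conv (conv s u) u" by (rule conv_commute[OF u])
  also have "\<dots> = (\<lambda>_. 0)" by (simp add: conv_assoc sq conv_zero_right)
  finally have yy: "conv y y = (\<lambda>_. 0)" by (simp add: conv_zero_right)
  have ystar: "y (inv g) = cnj (y g)" if g: "g \<in> carrier G" for g
  proof -
    have "y (inv g) = (\<Sum>h\<in>carrier G. cnj (u (h \<otimes> g)) * u h)"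
      unfolding y_def s_def using g by (auto simp: conv_apply inv_mult_group intro!: sum.cong)
    moreover have "y g = (\<Sum>h\<in>carrier G. cnj (u (h \<otimes> inv g)) * u h)"
      unfolding y_def s_def using g by (auto simp: conv_apply inv_mult_group intro!: sum.cong)
    moreover have "\<dots> = (\<Sum>k\<in>carrier G. cnj (u (k \<otimes> g \<otimes> inv g)) * u (k \<otimes> g))"
      using sum_right_mult[OF g, of "\<lambda>h. cnj (u (h \<otimes> inv g)) * u h"] by simp
    moreover have "\<dots> = (\<Sum>k\<in>carrier G. cnj (u k) * u (k \<otimes> g))"
      using g by (auto simp: m_assoc intro!: sum.cong)
    ultimately show ?thesis by (simp add: mult.commute)
  qed
  have norm_sum: "w h = 0" if "(\<Sum>h\<in>carrier G. cnj (w h) * w h) = 0" "h \<in> carrier G" for w h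
  proof -
    have "(\<Sum>h\<in>carrier G. cnj (w h) * w h) = of_real (\<Sum>h\<in>carrier G. (norm (w h))\<^sup>2)"
      by (simp only: of_real_sum complex_norm_square mult.commute)
    then have "(\<Sum>h\<in>carrier G. (norm (w h))\<^sup>2) = 0" using that(1) by (metis of_real_eq_0_iff)
    then show ?thesis using that(2) fin by (simp add: sum_nonneg_eq_0_iff)
  qed
  have "(\<Sum>h\<in>carrier G. cnj (y h) * y h) = conv y y \<one>"
    unfolding conv_one by (rule sum.cong) (auto simp: ystar)
  then have "y \<one> = 0" using norm_sum[of y \<one>] yy by simp
  moreover have "y \<one> = (\<Sum>h\<in>carrier G. cnj (u h) * u h)"
    unfolding y_def conv_one s_def by (rule sum.cong) auto
  ultimately show ?thesis using norm_sum[of u g] g by simp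
qed

section \<open>Polynomials evaluated at a group algebra element, and the spectral
  decomposition\<close>

definition ev :: "('a \<Rightarrow> complex) \<Rightarrow> complex poly \<Rightarrow> 'a \<Rightarrow> complex" where
  "ev z p = fold_coeffs (\<lambda>a w g. a * unit_mass g + conv z w g) p (\<lambda>_. 0)"

lemma ev_0 [simp]: "ev z 0 = (\<lambda>_. 0)"
  by (simp add: ev_def)

text \<open>Horner's rule with \<open>unit_mass\<close> as the unit. When both a and p are 0 the
  fold does no step at all, and the right side vanishes because convolution with 0 does.\<close>

lemma ev_pCons: "ev z (pCons a p) = (\<lambda>g. a * unit_mass g + conv z (ev z p) g)"
  by (cases "a = 0 \<and> p = 0") (auto simp: ev_def conv_zero_right fun_eq_iff)

lemma supported_ev [simp]: "supported (ev z p)"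
proof (induction p)
  case (pCons a p)
  then show ?case using supported_unit_mass supported_conv[of z "ev z p"]
    by (auto simp: ev_pCons supported_def)
qed (simp add: supported_def)

lemma class_function_ev:
  assumes "class_function G z"
  shows "class_function G (ev z p)"
proof (induction p)
  case (pCons a p)
  then show ?case
    using class_function_conv[OF assms pCons.IH] class_function_unit_mass
    by (auto simp: ev_pCons class_function_def)
qed (simp add: class_function_def)

lemma ev_add: "ev z (p + q) = (\<lambda>g. ev z p g + ev z q g)"
  by (induction p q rule: poly_induct2) (simp_all add: ev_pCons conv_add_right algebra_simps)

lemma ev_smult: "ev z (Polynomial.smult c p) = (\<lambda>g. c * ev z p g)"
  by (induction p) (simp_all add: ev_pCons conv_scale_right algebra_simps)

lemma ev_diff: "ev z (p - q) = (\<lambda>g. ev z p g - ev z q g)"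
proof -
  have "p - q = p + Polynomial.smult (- 1) q" by simp
  then show ?thesis by (simp only: ev_add ev_smult) simp
qed

lemma ev_sum: "ev z (sum F A) = (\<lambda>g. \<Sum>i\<in>A. ev z (F i) g)"
  by (induction A rule: infinite_finite_induct) (simp_all add: ev_add)

lemma ev_mult: "ev z (p * q) = conv (ev z p) (ev z q)"
proof (induction p)
  case (pCons a p)
  then show ?case
    by (simp add: mult_pCons_left ev_add ev_smult ev_pCons conv_add_left conv_scale_left
        conv_unit_mass_left conv_assoc)
qed (simp add: conv_zero_left)

lemma ev_X:
  assumes "supported z" "class_function G z"
  shows "ev z [:0, 1:] = z"
proof -
  have "conv z unit_mass = conv unit_mass z" by (rule conv_commute[OF assms(2)])
  then show ?thesis using assms(1) by (simp add: ev_pCons conv_zero_right conv_unit_mass_left)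
qed

lemma ev_eigenvector:
  assumes "supported v" "conv z v = (\<lambda>g. \<mu> * v g)"
  shows "conv (ev z p) v = (\<lambda>g. poly p \<mu> * v g)"
proof (induction p)
  case (pCons a p)
  have "conv (conv z (ev z p)) v = (\<lambda>g. poly p \<mu> * (\<mu> * v g))"
    unfolding conv_assoc pCons.IH conv_scale_right assms(2) ..
  then show ?case using assms(1)
    by (simp add: ev_pCons conv_add_left conv_scale_left conv_unit_mass_left algebra_simps fun_eq_iff)
qed (simp add: conv_zero_left)

text \<open>The first n + 1 powers of z live in a space of dimension n, the order of the
  group.\<close>

lemma annihilating_poly_exists: "\<exists>p. p \<noteq> 0 \<and> ev z p = (\<lambda>_. 0)"
proof -
  let ?n = "card (carrier G)"
  obtain c where c: "\<exists>i\<in>{..?n}. c i \<noteq> 0"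
    "\<forall>g\<in>carrier G. (\<Sum>i\<in>{..?n}. c i * ev z (monom 1 i) g) = 0"
    using nontrivial_relation[of "carrier G" "{..?n}" "\<lambda>i. ev z (monom 1 i)"] fin by auto
  define p where "p = (\<Sum>i\<le>?n. Polynomial.smult (c i) (monom 1 i))"
  have "ev z p = (\<lambda>g. \<Sum>i\<le>?n. c i * ev z (monom 1 i) g)" by (simp add: p_def ev_sum ev_smult)
  then have "ev z p g = 0" if "g \<in> carrier G" for g using c(2) that by simp
  then have "ev z p = (\<lambda>_. 0)" by (intro supported_eqI supported_ev) (auto simp: supported_def)
  moreover have "p \<noteq> 0"
  proof
    assume "p = 0"
    moreover have "coeff p i = c i" if "i \<le> ?n" for i
      using that by (simp add: p_def coeff_sum if_distrib cong: if_cong)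
    ultimately show False using c(1) by auto
  qed
  ultimately show ?thesis by blast
qed

text \<open>If q vanishes at all roots of p, then p divides a power of q, so q(z) is nilpotent, and
  the centre has no nonzero nilpotents. Multiplicities of the roots of p therefore do not
  matter.\<close>

lemma ev_eq_zero_of_roots:
  assumes z: "class_function G z" and p: "p \<noteq> 0" "ev z p = (\<lambda>_. 0)"
    and q: "\<And>x. poly p x = 0 \<Longrightarrow> poly q x = 0"
  shows "ev z q = (\<lambda>_. 0)"
proof -
  have "p dvd q ^ degree p" using nullstellensatz_univariate[of p q] p q by blast
  \<comment> \<open>The exponent is raised to a power of 2, so that repeated use of
    \<open>class_function_square_zero\<close> halves it down to 1.\<close>
  moreover have "q ^ degree p dvd q ^ 2 ^ degree p" by (rule le_imp_power_dvd) (simp add: less_imp_le)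
  ultimately have "p dvd q ^ 2 ^ degree p" by (rule dvd_trans)
  then obtain r where "q ^ 2 ^ degree p = p * r" by (auto elim: dvdE)
  then have "ev z (q ^ 2 ^ degree p) = (\<lambda>_. 0)" by (simp add: ev_mult p(2) conv_zero_left)
  moreover have "ev z q = (\<lambda>_. 0)" if "ev z (q ^ 2 ^ k) = (\<lambda>_. 0)" for k
    using that
  proof (induction k)
    case (Suc k)
    have "conv (ev z (q ^ 2 ^ k)) (ev z (q ^ 2 ^ k)) = (\<lambda>_. 0)"
      using Suc.prems by (simp add: ev_mult[symmetric] power_add[symmetric] mult_2)
    then have "ev z (q ^ 2 ^ k) = (\<lambda>_. 0)"
      using class_function_square_zero[OF class_function_ev[OF z]]
      by (intro supported_eqI supported_ev) (auto simp: supported_def)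
    then show ?case by (rule Suc.IH)
  qed simp
  ultimately show ?thesis by blast
qed

text \<open>By \<open>ev_eq_zero_of_roots\<close>, p(z) depends only on the values of p on the
  finite set R. Lagrange polynomials are idempotent as functions on R, so their values at z are
  idempotents, and interpolating X recovers z.\<close>

lemma spectral_decomposition:
  assumes z: "class_function G z" "supported z"
  obtains S E where "finite S"
    "\<And>\<mu>. \<mu> \<in> S \<Longrightarrow> class_function G (E \<mu>) \<and> supported (E \<mu>) \<and> E \<mu> \<noteq> (\<lambda>_. 0) \<and>
       conv (E \<mu>) (E \<mu>) = E \<mu> \<and> conv z (E \<mu>) = (\<lambda>g. \<mu> * E \<mu> g)"
    "\<And>g. z g = (\<Sum>\<mu>\<in>S. \<mu> * E \<mu> g)"
    "\<And>\<mu> v. supported v \<Longrightarrow> v \<noteq> (\<lambda>_. 0) \<Longrightarrow> conv z v = (\<lambda>g. \<mu> * v g) \<Longrightarrow> \<mu> \<in> S"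
proof -
  obtain p where p: "p \<noteq> 0" "ev z p = (\<lambda>_. 0)" using annihilating_poly_exists by blast
  define R where "R = {x. poly p x = 0}"
  have finR: "finite R" using p(1) by (simp add: R_def poly_roots_finite)
  define L where "L \<mu> = (\<Prod>\<nu>\<in>R - {\<mu>}. Polynomial.smult (1 / (\<mu> - \<nu>)) [:- \<nu>, 1:])" for \<mu>
  have L: "poly (L \<mu>) \<nu> = (if \<nu> = \<mu> then 1 else 0)" if "\<mu> \<in> R" "\<nu> \<in> R" for \<mu> \<nu>
  proof (cases "\<nu> = \<mu>")
    case True
    have "poly (Polynomial.smult (1 / (\<mu> - x)) [:- x, 1:]) \<mu> = 1" if "x \<noteq> \<mu>" for x
      unfolding poly_smult using that by (simp add: divide_simps)
    with True show ?thesis unfolding L_def poly_prod by (auto intro!: prod.neutral)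
  next
    case False
    then show ?thesis using that finR by (auto simp: L_def poly_prod intro!: prod_zero bexI[of _ \<nu>])
  qed
  define E where "E \<mu> = ev z (L \<mu>)" for \<mu>
  have eq: "ev z q = ev z r" if "\<And>x. x \<in> R \<Longrightarrow> poly q x = poly r x" for q r
  proof -
    have "ev z (q - r) = (\<lambda>_. 0)"
      by (rule ev_eq_zero_of_roots[OF z(1) p]) (use that in \<open>simp add: R_def\<close>)
    then show ?thesis by (simp add: ev_diff fun_eq_iff)
  qed
  \<comment> \<open>The annihilating polynomial is not claimed to be minimal, so a root may give the
    zero idempotent and is dropped here.\<close>
  define S where "S = {\<mu> \<in> R. E \<mu> \<noteq> (\<lambda>_. 0)}"
  show ?thesis
  proof (rule that)
    show "finite S" using finR by (simp add: S_def)
    fix \<mu> assume "\<mu> \<in> S"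
    then have \<mu>: "\<mu> \<in> R" "E \<mu> \<noteq> (\<lambda>_. 0)" by (auto simp: S_def)
    have "conv (E \<mu>) (E \<mu>) = E \<mu>"
      unfolding E_def ev_mult[symmetric] by (rule eq) (use L \<mu> in simp)
    moreover have "conv z (E \<mu>) = (\<lambda>g. \<mu> * E \<mu> g)"
    proof -
      have "ev z ([:0, 1:] * L \<mu>) = ev z (Polynomial.smult \<mu> (L \<mu>))"
        by (rule eq) (use L \<mu> in simp)
      then show ?thesis unfolding ev_mult ev_X[OF z(2,1)] ev_smult E_def .
    qed
    ultimately show "class_function G (E \<mu>) \<and> supported (E \<mu>) \<and> E \<mu> \<noteq> (\<lambda>_. 0) \<and>
       conv (E \<mu>) (E \<mu>) = E \<mu> \<and> conv z (E \<mu>) = (\<lambda>g. \<mu> * E \<mu> g)"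
      using \<mu>(2) by (simp add: E_def class_function_ev[OF z(1)])
  next
    fix g
    have "ev z [:0, 1:] = ev z (\<Sum>\<mu>\<in>R. Polynomial.smult \<mu> (L \<mu>))"
      by (rule eq) (simp add: poly_sum L finR if_distrib cong: if_cong)
    then have "z = (\<lambda>g. \<Sum>\<mu>\<in>R. \<mu> * E \<mu> g)"
      unfolding ev_X[OF z(2,1)] by (simp add: ev_sum ev_smult E_def)
    then have "z g = (\<Sum>\<mu>\<in>R. \<mu> * E \<mu> g)" by (rule fun_cong)
    also have "\<dots> = (\<Sum>\<mu>\<in>S. \<mu> * E \<mu> g)"
      by (rule sum.mono_neutral_right) (use finR in \<open>auto simp: S_def\<close>)
    finally show "z g = (\<Sum>\<mu>\<in>S. \<mu> * E \<mu> g)" .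
  next
    fix \<mu> v assume v: "supported v" "v \<noteq> (\<lambda>_. 0)" "conv z v = (\<lambda>g. \<mu> * v g)"
    obtain g where g: "v g \<noteq> 0" using v(2) by auto
    have "(\<lambda>g. poly p \<mu> * v g) = (\<lambda>_. 0)"
      using ev_eigenvector[OF v(1,3), of p] p(2) by (simp add: conv_zero_left)
    then have \<mu>: "\<mu> \<in> R" using g by (auto simp: R_def fun_eq_iff)
    \<comment> \<open>The idempotent acts on an eigenvector for \<mu> by the value of its Lagrange
      polynomial at \<mu>, which is 1; so it cannot be zero.\<close>
    have "conv (E \<mu>) v = v" using ev_eigenvector[OF v(1,3), of "L \<mu>"] L[OF \<mu> \<mu>] by (simp add: E_def)
    then have "E \<mu> \<noteq> (\<lambda>_. 0)" using v(2) by (auto simp: conv_zero_left)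
    then show "\<mu> \<in> S" using \<mu> by (simp add: S_def)
  qed
qed

text \<open>The matrix of convolution by e is idempotent and has e(1) in every diagonal place, so
  its rational trace is n e(1). Idempotents outside the centre must be covered, as twisting by a
  cyclic subgroup produces them.\<close>

lemma idempotent_one_rational:
  assumes idem: "conv e e = e"
  shows "e \<one> \<in> \<rat>"
proof -
  let ?n = "card (carrier G)"
  obtain b where b: "bij_betw b {0..<?n} (carrier G)" using ex_bij_betw_nat_finite[OF fin] by blast
  have bC: "b i \<in> carrier G" if "i < ?n" for i using b that by (auto simp: bij_betw_def)
  define A where "A = mat ?n ?n (\<lambda>(i, j). e (b i \<otimes> inv b j))"
  have A: "A \<in> carrier_mat ?n ?n" by (simp add: A_def)
  have "A * A = A"
  proof (rule eq_matI)
    fix i j assume "i < dim_row A" "j < dim_col A"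
    then have ij: "i < ?n" "j < ?n" by (auto simp: A_def)
    have "(A * A) $$ (i, j) = (\<Sum>k\<in>{0..<?n}. e (b i \<otimes> inv b k) * e (b k \<otimes> inv b j))"
      using ij by (simp add: A_def scalar_prod_def)
    also have "\<dots> = (\<Sum>h\<in>carrier G. e (b i \<otimes> inv h) * e (h \<otimes> inv b j))"
      by (rule sum.reindex_bij_betw[OF b])
    also have "\<dots> = (\<Sum>k\<in>carrier G. e (b i \<otimes> inv (k \<otimes> b j)) * e (k \<otimes> b j \<otimes> inv b j))"
      using sum_right_mult[OF bC[OF ij(2)], of "\<lambda>h. e (b i \<otimes> inv h) * e (h \<otimes> inv b j)"] by simp
    also have "\<dots> = (\<Sum>k\<in>carrier G. e (b i \<otimes> inv b j \<otimes> inv k) * e k)"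
      by (rule sum.cong) (use bC ij in \<open>auto simp: inv_mult_group m_assoc\<close>)
    also have "\<dots> = conv e e (b i \<otimes> inv b j)" using bC ij by (simp add: conv_apply)
    finally show "(A * A) $$ (i, j) = A $$ (i, j)" unfolding idem using ij by (simp add: A_def)
  qed (auto simp: A_def)
  from trace_idempotent_rational[OF A this] have "of_nat ?n * e \<one> \<in> \<rat>"
    using bC by (simp add: A_def)
  moreover have "?n \<noteq> 0" using fin by auto
  ultimately have "(of_nat ?n * e \<one>) / of_nat ?n \<in> \<rat>" by (intro Rats_divide) auto
  then show ?thesis using \<open>?n \<noteq> 0\<close> by simp
qed

end

section \<open>Galois action on central idempotents\<close>

lemma sum_periodic_shift:
  fixes F :: "nat \<Rightarrow> 'b :: ab_group_add"
  assumes "\<And>j. F (j + n) = F j"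
  shows "(\<Sum>j<n. F (i + j)) = (\<Sum>j<n. F j)"
proof (induction i)
  case (Suc i)
  have "(\<Sum>j<n. F (Suc i + j)) + F i = (\<Sum>j<Suc n. F (i + j))"
    by (subst sum.lessThan_Suc_shift) (simp add: add.commute)
  also have "\<dots> = (\<Sum>j<n. F (i + j)) + F i" using assms by simp
  finally show ?case using Suc.IH by simp
qed simp

lemma sum_powers_root_of_unity:
  fixes w :: "'b :: field"
  assumes "w ^ n = 1"
  shows "(\<Sum>k<n. w ^ k) = (if w = 1 then of_nat n else 0)"
  using assms by (simp add: geometric_sum)

text \<open>\<open>units_mod\<close> takes residues from 0 to n - 1, totatives run from 1 to n; the
  two sets differ only for n = 1, where they are {0} and {1}.\<close>

lemma card_units_mod: "0 < n \<Longrightarrow> card (units_mod n) = totient n"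
proof (cases "n = 1")
  case True
  then have "units_mod n = {0}" by (auto simp: units_mod_def)
  then show ?thesis using True by simp
next
  case False
  assume n: "0 < n"
  have "units_mod n = totatives n"
  proof (rule Set.set_eqI)
    show "k \<in> units_mod n \<longleftrightarrow> k \<in> totatives n" for k
      using n False by (cases "k = 0 \<or> k = n") (auto simp: units_mod_def in_totatives_iff)
  qed
  then show ?thesis by (simp add: totient_def)
qed

lemma rat_degree_Rats: "rat_degree \<rat> = 1"
proof -
  have "Qvs.independent {1 :: complex}" by simp
  moreover have "Qvs.span {1 :: complex} = Qvs.span \<rat>"
  proof
    show "Qvs.span {1 :: complex} \<subseteq> Qvs.span \<rat>" by (rule Qvs.span_mono) auto
    have "\<rat> \<subseteq> Qvs.span {1 :: complex}"
    proof
      fix x :: complex assume "x \<in> \<rat>"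
      then obtain r where "x = of_rat r * 1" by (auto elim: Rats_cases)
      then show "x \<in> Qvs.span {1}" using Qvs.span_scale[OF Qvs.span_base[of 1 "{1}"], of r] by simp
    qed
    then show "Qvs.span \<rat> \<subseteq> Qvs.span {1 :: complex}"
      by (simp add: Qvs.span_minimal Qvs.subspace_span)
  qed
  ultimately show ?thesis unfolding rat_degree_def using Qvs.dim_eq_card[of "{1}" \<rat>] by simp
qed

lemma polys_over_mono: "F \<subseteq> F' \<Longrightarrow> polys_over F \<subseteq> polys_over F'"
  by (auto simp: polys_over_def)

lemma (in complex_subfield) Rats_subset: "\<rat> \<subseteq> F"
  by (auto elim: Rats_cases)

section \<open>Automorphisms of subfields and their fixed fields\<close>

locale complex_field_aut = complex_subfield K for K +
  fixes \<sigma> :: "complex \<Rightarrow> complex"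
  assumes aut: "field_aut_C K \<sigma>"
begin

lemma hom_add: "x \<in> K \<Longrightarrow> y \<in> K \<Longrightarrow> \<sigma> (x + y) = \<sigma> x + \<sigma> y"
  and hom_mult: "x \<in> K \<Longrightarrow> y \<in> K \<Longrightarrow> \<sigma> (x * y) = \<sigma> x * \<sigma> y"
  and hom_one: "\<sigma> 1 = 1"
  using aut by (auto simp: field_aut_C_def)

lemma hom_zero: "\<sigma> 0 = 0"
  using field_aut_zero[OF subfield aut] .

lemma hom_uminus: "x \<in> K \<Longrightarrow> \<sigma> (- x) = - \<sigma> x"
  using hom_add[of x "- x"] hom_zero by (auto simp: eq_neg_iff_add_eq_0 add.commute)

lemma hom_inverse: "x \<in> K \<Longrightarrow> \<sigma> (inverse x) = inverse (\<sigma> x)"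
  using hom_mult[of x "inverse x"] hom_one hom_zero
  by (cases "x = 0") (auto intro: inverse_unique[symmetric])

lemma hom_sum: "(\<And>i. i \<in> A \<Longrightarrow> F i \<in> K) \<Longrightarrow> \<sigma> (sum F A) = (\<Sum>i\<in>A. \<sigma> (F i))"
proof (induction A rule: infinite_finite_induct)
  case (insert i A)
  then have "\<sigma> (F i + sum F A) = \<sigma> (F i) + \<sigma> (sum F A)" by (intro hom_add) auto
  then show ?case using insert by simp
qed (simp_all add: hom_zero)

lemma hom_of_nat: "\<sigma> (of_nat k) = of_nat k"
  by (induction k) (simp_all add: hom_zero hom_add hom_one)

lemma hom_of_int: "\<sigma> (of_int k) = of_int k"
  by (cases k) (simp_all add: hom_of_nat hom_uminus del: of_nat_Suc)

lemma hom_Rats: "x \<in> \<rat> \<Longrightarrow> \<sigma> x = x"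
proof -
  assume "x \<in> \<rat>"
  then obtain a b where "x = of_int a * inverse (of_int b)"
    by (auto elim!: Rats_cases' simp: divide_inverse)
  then show ?thesis by (simp add: hom_mult hom_of_int hom_inverse inverse_closed)
qed

end

lemma subfield_fixed_field:
  assumes K: "subfield_C K" and S: "\<And>\<sigma>. \<sigma> \<in> S \<Longrightarrow> field_aut_C K \<sigma>"
  shows "subfield_C (fixed_field K S)"
proof -
  interpret K: complex_subfield K by standard (rule K)
  have hom: "complex_field_aut K \<sigma>" if "\<sigma> \<in> S" for \<sigma>
    using K S[OF that] by unfold_locales
  show ?thesis
    unfolding subfield_C_def fixed_field_def
    by (auto simp: complex_field_aut.hom_add[OF hom] complex_field_aut.hom_mult[OF hom]
        complex_field_aut.hom_one[OF hom] complex_field_aut.hom_zero[OF hom]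
        complex_field_aut.hom_uminus[OF hom] complex_field_aut.hom_inverse[OF hom])
qed

section \<open>Cyclotomic values of central idempotents\<close>

context finite_group
begin

lemma card_carrier_pos: "0 < card (carrier G)"
  using fin by (auto simp: card_gt_0_iff)

lemma pow_card_carrier: "g \<in> carrier G \<Longrightarrow> g [^] card (carrier G) = \<one>"
  using pow_order_eq_1 by (simp add: Coset.order_def)

lemma pow_cong_card:
  assumes "g \<in> carrier G" "[i = j] (mod card (carrier G))"
  shows "g [^] i = g [^] j"
proof -
  have "g [^] (k mod card (carrier G)) = g [^] k" for k :: nat
  proof -
    have "g [^] k = g [^] (card (carrier G) * (k div card (carrier G)) + k mod card (carrier G))" by simp
    also have "\<dots> = g [^] (k mod card (carrier G))"
      using assms(1) by (simp only: nat_pow_mult[symmetric] nat_pow_pow[symmetric] pow_card_carrier) simp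
    finally show ?thesis by simp
  qed
  then show ?thesis using assms(2) by (metis cong_def)
qed

text \<open>Here t is the product of e with the average over j < n of \<open>w ^ j\<close> times the
  inverse of \<open>g [^] j\<close>. That average is idempotent because w and g both have n-th power
  1, and it commutes with e.\<close>

lemma conv_twist_idempotent:
  assumes e: "class_function G e" "conv e e = e" and g: "g \<in> carrier G"
    and w: "w ^ card (carrier G) = 1"
  defines "t \<equiv> (\<lambda>y. if y \<in> carrier G then
      (\<Sum>j<card (carrier G). w ^ j * e (y \<otimes> g [^] j)) / of_nat (card (carrier G)) else 0)"
  shows "conv t t = t"
proof (rule supported_eqI)
  let ?n = "card (carrier G)"
  show "supported t" by (simp add: supported_def t_def)
  fix y assume y: "y \<in> carrier G"
  define F where "F j = w ^ j * e (y \<otimes> g [^] j)" for j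
  have per: "F (j + ?n) = F j" for j
    using g by (simp add: F_def power_add w nat_pow_mult[symmetric] pow_card_carrier)
  \<comment> \<open>Translates of e by two powers of g convolve to the translate by their product;
    centrality of e moves \<open>g [^] i\<close> past the other factors.\<close>
  have key: "(\<Sum>h\<in>carrier G. e (y \<otimes> inv h \<otimes> g [^] i) * e (h \<otimes> g [^] j)) = e (y \<otimes> g [^] (i + j))"
    for i j :: nat
  proof -
    let ?a = "g [^] i" and ?b = "g [^] j"
    have ab: "?a \<in> carrier G" "?b \<in> carrier G" using g by auto
    have "(\<Sum>h\<in>carrier G. e (y \<otimes> inv h \<otimes> ?a) * e (h \<otimes> ?b)) =
      (\<Sum>k\<in>carrier G. e (y \<otimes> inv (k \<otimes> inv ?b) \<otimes> ?a) * e (k \<otimes> inv ?b \<otimes> ?b))"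
      using sum_right_mult[of "inv ?b" "\<lambda>h. e (y \<otimes> inv h \<otimes> ?a) * e (h \<otimes> ?b)"] ab by simp
    also have "\<dots> = (\<Sum>k\<in>carrier G. e (?a \<otimes> (y \<otimes> ?b) \<otimes> inv k) * e k)"
    proof (rule sum.cong[OF refl])
      fix k assume k: "k \<in> carrier G"
      have "e (y \<otimes> inv (k \<otimes> inv ?b) \<otimes> ?a) = e (?a \<otimes> (y \<otimes> inv (k \<otimes> inv ?b)))"
        using class_function_swap[OF e(1)] ab y k by simp
      also have "?a \<otimes> (y \<otimes> inv (k \<otimes> inv ?b)) = ?a \<otimes> (y \<otimes> ?b) \<otimes> inv k"
        using ab y k by (simp add: inv_mult_group m_assoc)
      finally show "e (y \<otimes> inv (k \<otimes> inv ?b) \<otimes> ?a) * e (k \<otimes> inv ?b \<otimes> ?b) =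
        e (?a \<otimes> (y \<otimes> ?b) \<otimes> inv k) * e k" using ab k by (simp add: m_assoc)
    qed
    also have "\<dots> = conv e e (?a \<otimes> (y \<otimes> ?b))" using ab y by (simp add: conv_apply)
    also have "\<dots> = e (y \<otimes> ?b \<otimes> ?a)" using e(2) class_function_swap[OF e(1)] ab y by simp
    also have "y \<otimes> ?b \<otimes> ?a = y \<otimes> g [^] (i + j)"
      using g y by (simp add: m_assoc nat_pow_mult add.commute)
    finally show ?thesis .
  qed
  have tn: "t x * of_nat ?n = (\<Sum>j<?n. w ^ j * e (x \<otimes> g [^] j))" if "x \<in> carrier G" for x
    using that card_carrier_pos by (simp add: t_def)
  have "conv t t y * (of_nat ?n * of_nat ?n) =
      (\<Sum>h\<in>carrier G. (t (y \<otimes> inv h) * of_nat ?n) * (t h * of_nat ?n))"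
    using y by (simp add: conv_apply sum_distrib_left mult_ac)
  also have "\<dots> = (\<Sum>h\<in>carrier G.
      (\<Sum>i<?n. w ^ i * e (y \<otimes> inv h \<otimes> g [^] i)) * (\<Sum>j<?n. w ^ j * e (h \<otimes> g [^] j)))"
    using y by (intro sum.cong) (simp_all add: tn)
  also have "\<dots> = (\<Sum>h\<in>carrier G. \<Sum>i<?n. \<Sum>j<?n.
      w ^ (i + j) * (e (y \<otimes> inv h \<otimes> g [^] i) * e (h \<otimes> g [^] j)))"
    unfolding sum_product by (simp add: power_add mult_ac)
  also have "\<dots> = (\<Sum>i<?n. \<Sum>h\<in>carrier G. \<Sum>j<?n.
      w ^ (i + j) * (e (y \<otimes> inv h \<otimes> g [^] i) * e (h \<otimes> g [^] j)))"
    by (rule sum.swap)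
  also have "\<dots> = (\<Sum>i<?n. \<Sum>j<?n. \<Sum>h\<in>carrier G.
      w ^ (i + j) * (e (y \<otimes> inv h \<otimes> g [^] i) * e (h \<otimes> g [^] j)))"
    by (intro sum.cong refl sum.swap)
  also have "\<dots> = (\<Sum>i<?n. \<Sum>j<?n. F (i + j))"
    by (simp add: sum_distrib_left[symmetric] key F_def)
  \<comment> \<open>The summand has period n, so each shift by i gives the same full-period
    sum.\<close>
  also have "\<dots> = of_nat ?n * (\<Sum>j<?n. F j)" by (simp add: sum_periodic_shift[of F, OF per])
  also have "\<dots> = t y * (of_nat ?n * of_nat ?n)"
    using y card_carrier_pos by (simp add: t_def F_def)
  finally show "conv t t y = t y" using card_carrier_pos by simp
qed simp

text \<open>The polynomial is the discrete Fourier transform of \<open>j \<mapsto> e (g\<^sup>j)\<close>; its coefficients are values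
  at the identity of idempotents, hence rational.\<close>
lemma central_idempotent_on_powers:
  assumes e: "class_function G e" "conv e e = e" and g: "g \<in> carrier G"
  shows "\<exists>p\<in>polys_over \<rat>. \<forall>l. e (g [^] l) = poly p (zeta (card (carrier G)) ^ l)"
proof -
  let ?n = "card (carrier G)"
  let ?z = "zeta ?n"
  interpret Q: complex_subfield \<rat> by standard (rule subfield_Rats)
  \<comment> \<open>The value at the identity of the twist of e with w = zeta^(-k).\<close>
  define q where "q k = (\<Sum>j<?n. inverse (?z ^ k) ^ j * e (g [^] j)) / of_nat ?n" for k
  have "q k \<in> \<rat>" for k
  proof -
    have "(?z ^ k) ^ ?n = 1"
      by (metis card_carrier_pos mult.commute power_mult power_one zeta_power_self)
    then have w: "inverse (?z ^ k) ^ ?n = 1" by (simp add: power_inverse)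
    show ?thesis
      using idempotent_one_rational[OF conv_twist_idempotent[OF e g w]] g by (simp add: q_def)
  qed
  define p where "p = (\<Sum>k<?n. monom (q k) k)"
  have "p \<in> polys_over \<rat>" using \<open>\<And>k. q k \<in> \<rat>\<close> by (auto simp: p_def)
  moreover have "e (g [^] l) = poly p (?z ^ l)" for l :: nat
  proof -
    \<comment> \<open>Orthogonality of roots of unity for Fourier inversion; reducing l modulo n
      allows arbitrary exponents l.\<close>
    have inner: "(\<Sum>k<?n. inverse (?z ^ k) ^ j * (?z ^ l) ^ k) = (if j = l mod ?n then of_nat ?n else 0)"
      if j: "j < ?n" for j
    proof -
      define w where "w = ?z ^ l / ?z ^ j"
      have "w ^ ?n = (?z ^ ?n) ^ l / (?z ^ ?n) ^ j"
        by (simp add: w_def power_divide mult.commute flip: power_mult)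
      then have w: "w ^ ?n = 1" using card_carrier_pos by simp
      have "w = 1 \<longleftrightarrow> ?z ^ l = ?z ^ j" by (simp add: w_def)
      also have "\<dots> \<longleftrightarrow> j = l mod ?n"
        using zeta_power_eq_iff[OF card_carrier_pos] j by (auto simp: cong_def)
      finally have "w = 1 \<longleftrightarrow> j = l mod ?n" .
      moreover have "inverse (?z ^ k) ^ j * (?z ^ l) ^ k = w ^ k" for k
        by (simp add: w_def power_inverse divide_inverse power_mult_distrib mult.commute flip: power_mult)
      ultimately show ?thesis using sum_powers_root_of_unity[OF w] by simp
    qed
    have qn: "q k * of_nat ?n = (\<Sum>j<?n. inverse (?z ^ k) ^ j * e (g [^] j))" for k
      using card_carrier_pos by (simp add: q_def)
    have "poly p (?z ^ l) * of_nat ?n = (\<Sum>k<?n. (q k * of_nat ?n) * (?z ^ l) ^ k)"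
      by (simp add: p_def poly_sum poly_monom sum_distrib_left mult_ac)
    also have "\<dots> = (\<Sum>k<?n. (\<Sum>j<?n. inverse (?z ^ k) ^ j * e (g [^] j)) * (?z ^ l) ^ k)"
      unfolding qn ..
    also have "\<dots> = (\<Sum>k<?n. \<Sum>j<?n. e (g [^] j) * (inverse (?z ^ k) ^ j * (?z ^ l) ^ k))"
      unfolding sum_distrib_right by (simp add: mult_ac)
    also have "\<dots> = (\<Sum>j<?n. e (g [^] j) * (\<Sum>k<?n. inverse (?z ^ k) ^ j * (?z ^ l) ^ k))"
      by (subst sum.swap) (simp add: sum_distrib_left)
    also have "\<dots> = (\<Sum>j<?n. if j = l mod ?n then e (g [^] j) * of_nat ?n else 0)"
      by (intro sum.cong) (auto simp: inner)
    also have "\<dots> = e (g [^] (l mod ?n)) * of_nat ?n" using card_carrier_pos by simp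
    also have "g [^] (l mod ?n) = g [^] l" by (rule pow_cong_card[OF g]) (simp add: cong_def)
    finally show ?thesis using card_carrier_pos by simp
  qed
  ultimately show ?thesis by blast
qed

text \<open>One rational polynomial p gives the values of e at all powers of g, so \<sigma> turns
  p(zeta) = e(g) into p(zeta^h) = e(g^h).\<close>

lemma central_idempotent_galois:
  assumes e: "class_function G e" "conv e e = e" and g: "g \<in> carrier G"
    and \<sigma>: "field_aut_C (cyclotomic_field (card (carrier G))) \<sigma>"
      "\<sigma> (zeta (card (carrier G))) = zeta (card (carrier G)) ^ h"
  shows "\<sigma> (e g) = e (g [^] h)"
proof -
  let ?n = "card (carrier G)"
  let ?K = "cyclotomic_field ?n"
  interpret complex_field_aut ?K \<sigma>
    using \<sigma>(1) by unfold_locales (simp_all add: cyclotomic_field_def subfield_gen_field)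
  obtain p where p: "p \<in> polys_over \<rat>" "\<And>l. e (g [^] l) = poly p (zeta ?n ^ l)"
    using central_idempotent_on_powers[OF e g] by blast
  have mem: "zeta ?n \<in> ?K" using gen_field_contains[of "{zeta ?n}"] by (simp add: cyclotomic_field_def)
  have "p \<in> polys_over ?K" using p(1) polys_over_mono[OF Rats_subset] by blast
  then have "\<sigma> (poly p (zeta ?n)) = poly p (\<sigma> (zeta ?n))"
    using p(1) by (intro field_aut_poly[OF subfield aut _ _ mem] hom_Rats) (auto simp: polys_over_def)
  then show ?thesis using p(2)[of 1] p(2)[of h] \<sigma>(2) g by simp
qed

lemma central_idempotent_in_cyclotomic_field:
  assumes e: "class_function G e" "conv e e = e" and g: "g \<in> carrier G"
  shows "e g \<in> cyclotomic_field (card (carrier G))"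
proof -
  let ?n = "card (carrier G)"
  let ?K = "cyclotomic_field ?n"
  interpret complex_subfield ?K
    by standard (simp add: cyclotomic_field_def subfield_gen_field)
  obtain p where p: "p \<in> polys_over \<rat>" "\<And>l. e (g [^] l) = poly p (zeta ?n ^ l)"
    using central_idempotent_on_powers[OF e g] by blast
  have "zeta ?n \<in> ?K" using gen_field_contains[of "{zeta ?n}"] by (simp add: cyclotomic_field_def)
  moreover have "p \<in> polys_over ?K" using p(1) polys_over_mono[OF Rats_subset] by blast
  ultimately show ?thesis using p(2)[of 1] g poly_closed by simp
qed

text \<open>Complex conjugation sends zeta to zeta^(n-1) and fixes rational coefficients, while
  g^(n-1) is the inverse of g.\<close>

lemma central_idempotent_inv:
  assumes e: "class_function G e" "conv e e = e" and g: "g \<in> carrier G"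
  shows "e (inv g) = cnj (e g)"
proof -
  let ?n = "card (carrier G)"
  obtain p where p: "p \<in> polys_over \<rat>" "\<And>l. e (g [^] l) = poly p (zeta ?n ^ l)"
    using central_idempotent_on_powers[OF e g] by blast
  have "g [^] (?n - 1) \<otimes> g = g [^] ?n"
    using g card_carrier_pos by (metis Suc_diff_1 nat_pow_Suc)
  then have inv: "inv g = g [^] (?n - 1)" using g by (intro inv_equality) (auto simp: pow_card_carrier)
  have "zeta ?n ^ (?n - 1) * zeta ?n = 1"
    using card_carrier_pos by (metis Suc_diff_1 power_Suc2 zeta_power_self)
  moreover have "cnj (zeta ?n) * zeta ?n = 1"
    using complex_norm_square[of "zeta ?n"] by (simp add: zeta_def mult.commute)
  ultimately have z: "zeta ?n ^ (?n - 1) = cnj (zeta ?n)"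
    by (metis mult_right_cancel zeta_nonzero)
  have "cnj (coeff p i) = coeff p i" for i
    using p(1) by (auto simp: polys_over_def elim!: Rats_cases' dest!: spec[of _ i])
  then have "poly p (cnj (zeta ?n)) = cnj (poly p (zeta ?n))"
    by (simp add: poly_altdef)
  then show ?thesis using p(2)[of 1] p(2)[of "?n - 1"] g z inv by simp
qed

text \<open>Since e is self-adjoint, e(1) = (e * e)(1) is the sum of the squared absolute values of
  e. This permits division by e(1) when solving for an eigenvalue.\<close>

lemma central_idempotent_one_nonzero:
  assumes e: "class_function G e" "conv e e = e" "supported e" "e \<noteq> (\<lambda>_. 0)"
  shows "e \<one> \<noteq> 0"
proof
  assume zero: "e \<one> = 0"
  have "e \<one> = (\<Sum>h\<in>carrier G. e (inv h) * e h)" using e(2) conv_one by metis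
  also have "\<dots> = of_real (\<Sum>h\<in>carrier G. (norm (e h))\<^sup>2)"
    by (simp only: of_real_sum complex_norm_square mult.commute) (auto simp: central_idempotent_inv[OF e(1,2)])
  finally have "(\<Sum>h\<in>carrier G. (norm (e h))\<^sup>2) = 0" using zero by (metis of_real_eq_0_iff)
  then have "\<forall>h\<in>carrier G. e h = 0" using fin by (simp add: sum_nonneg_eq_0_iff)
  then have "e = (\<lambda>_. 0)" using e(3) by (intro supported_eqI) (auto simp: supported_def)
  then show False using e(4) by contradiction
qed

section \<open>The spectrum of the Cayley colour graph\<close>

definition group_algebra_element :: "('a \<Rightarrow> rat) \<Rightarrow> 'a \<Rightarrow> complex" where
  "group_algebra_element f g = (if g \<in> carrier G then of_rat (f g) else 0)"

lemma cayley_eigenvalues_iff: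
  "\<mu> \<in> cayley_eigenvalues G f \<longleftrightarrow>
     (\<exists>v. supported v \<and> v \<noteq> (\<lambda>_. 0) \<and> conv (group_algebra_element f) v = (\<lambda>g. \<mu> * v g))"
proof
  assume "\<mu> \<in> cayley_eigenvalues G f"
  then obtain v x where x: "x \<in> carrier G" "v x \<noteq> 0"
    and v: "\<And>g. g \<in> carrier G \<Longrightarrow> (\<Sum>h\<in>carrier G. of_rat (f (g \<otimes> inv h)) * v h) = \<mu> * v g"
    by (auto simp: cayley_eigenvalues_def)
  \<comment> \<open>Off the carrier an eigenvector is arbitrary, while a convolution vanishes
    there.\<close>
  define v' where "v' g = (if g \<in> carrier G then v g else 0)" for g
  have "supported v'" by (simp add: supported_def v'_def)
  moreover have "v' \<noteq> (\<lambda>_. 0)" using x by (auto simp: v'_def fun_eq_iff)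
  moreover have "conv (group_algebra_element f) v' = (\<lambda>g. \<mu> * v' g)"
  proof (rule supported_eqI[OF supported_conv])
    show "supported (\<lambda>g. \<mu> * v' g)" by (simp add: supported_def v'_def)
  qed (simp add: v'_def conv_apply group_algebra_element_def v)
  ultimately show "\<exists>v. supported v \<and> v \<noteq> (\<lambda>_. 0) \<and> conv (group_algebra_element f) v = (\<lambda>g. \<mu> * v g)"
    by blast
next
  assume "\<exists>v. supported v \<and> v \<noteq> (\<lambda>_. 0) \<and> conv (group_algebra_element f) v = (\<lambda>g. \<mu> * v g)"
  then obtain v where v: "supported v" "v \<noteq> (\<lambda>_. 0)" "conv (group_algebra_element f) v = (\<lambda>g. \<mu> * v g)"
    by blast
  have "(\<Sum>h\<in>carrier G. of_rat (f (g \<otimes> inv h)) * v h) = \<mu> * v g" if "g \<in> carrier G" for g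
    using fun_cong[OF v(3), of g] that by (simp add: conv_apply group_algebra_element_def)
  moreover have "\<exists>g\<in>carrier G. v g \<noteq> 0" using v(1,2) by (auto simp: supported_def fun_eq_iff)
  ultimately show "\<mu> \<in> cayley_eigenvalues G f" unfolding cayley_eigenvalues_def by blast
qed

text \<open>Two dual formulas, one for each direction of the Galois comparison: every eigenvalue
  expressed through f, by evaluating the eigenvector equation for \<open>E \<mu>\<close> at the
  identity, and f expressed through the eigenvalues.\<close>

lemma cayley_spectral_decomposition:
  assumes f: "class_function G f"
  obtains E where "finite (cayley_eigenvalues G f)"
    "\<And>\<mu>. \<mu> \<in> cayley_eigenvalues G f \<Longrightarrow> class_function G (E \<mu>)"
    "\<And>\<mu>. \<mu> \<in> cayley_eigenvalues G f \<Longrightarrow> conv (E \<mu>) (E \<mu>) = E \<mu>"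
    "\<And>\<mu>. \<mu> \<in> cayley_eigenvalues G f \<Longrightarrow> E \<mu> \<one> \<noteq> 0"
    "\<And>\<mu>. \<mu> \<in> cayley_eigenvalues G f \<Longrightarrow> \<mu> = (\<Sum>h\<in>carrier G. of_rat (f (inv h)) * E \<mu> h) / E \<mu> \<one>"
    "\<And>g. g \<in> carrier G \<Longrightarrow> of_rat (f g) = (\<Sum>\<mu>\<in>cayley_eigenvalues G f. \<mu> * E \<mu> g)"
proof -
  let ?z = "group_algebra_element f"
  have "class_function G ?z" "supported ?z"
    using f by (auto simp: class_function_def supported_def group_algebra_element_def)
  from spectral_decomposition[OF this] obtain S E where S: "finite S"
    and E: "\<And>\<mu>. \<mu> \<in> S \<Longrightarrow> class_function G (E \<mu>) \<and> supported (E \<mu>) \<and> E \<mu> \<noteq> (\<lambda>_. 0) \<and>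
       conv (E \<mu>) (E \<mu>) = E \<mu> \<and> conv ?z (E \<mu>) = (\<lambda>g. \<mu> * E \<mu> g)"
    and sum: "\<And>g. ?z g = (\<Sum>\<mu>\<in>S. \<mu> * E \<mu> g)"
    and eig: "\<And>\<mu> v. supported v \<Longrightarrow> v \<noteq> (\<lambda>_. 0) \<Longrightarrow> conv ?z v = (\<lambda>g. \<mu> * v g) \<Longrightarrow> \<mu> \<in> S"
    by blast
  have SE: "cayley_eigenvalues G f = S"
  proof (rule Set.set_eqI)
    show "\<mu> \<in> cayley_eigenvalues G f \<longleftrightarrow> \<mu> \<in> S" for \<mu>
      unfolding cayley_eigenvalues_iff using E[of \<mu>] eig by blast
  qed
  have one: "E \<mu> \<one> \<noteq> 0" if "\<mu> \<in> S" for \<mu>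
    using central_idempotent_one_nonzero E[OF that] by blast
  show ?thesis
  proof (rule that[of E, unfolded SE])
    fix \<mu> assume \<mu>: "\<mu> \<in> S"
    have "\<mu> * E \<mu> \<one> = conv ?z (E \<mu>) \<one>" using E[OF \<mu>] by simp
    also have "\<dots> = (\<Sum>h\<in>carrier G. of_rat (f (inv h)) * E \<mu> h)"
      unfolding conv_one by (intro sum.cong) (auto simp: group_algebra_element_def)
    finally show "\<mu> = (\<Sum>h\<in>carrier G. of_rat (f (inv h)) * E \<mu> h) / E \<mu> \<one>"
      using one[OF \<mu>] by (simp add: field_simps)
  next
    fix g assume "g \<in> carrier G"
    then show "of_rat (f g) = (\<Sum>\<mu>\<in>S. \<mu> * E \<mu> g)"
      using sum[of g] by (simp add: group_algebra_element_def)
  qed (use S E one in auto)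
qed

lemma cayley_eigenvalues_cyclotomic:
  assumes f: "class_function G f"
  shows "cayley_eigenvalues G f \<subseteq> cyclotomic_field (card (carrier G))"
proof
  fix \<mu> assume \<mu>: "\<mu> \<in> cayley_eigenvalues G f"
  interpret K: complex_subfield "cyclotomic_field (card (carrier G))"
    by standard (simp add: cyclotomic_field_def subfield_gen_field)
  obtain E where E: "class_function G (E \<mu>)" "conv (E \<mu>) (E \<mu>) = E \<mu>"
    "\<mu> = (\<Sum>h\<in>carrier G. of_rat (f (inv h)) * E \<mu> h) / E \<mu> \<one>"
    by (rule cayley_spectral_decomposition[OF f]) (use \<mu> in blast)
  show "\<mu> \<in> cyclotomic_field (card (carrier G))"
    by (subst E(3)) (intro K.divide_closed K.sum_closed K.mult_closed K.of_rat_closed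
        central_idempotent_in_cyclotomic_field[OF E(1,2)]; simp)
qed

text \<open>Raising to the k-th power permutes the group, even when it is no homomorphism: an
  inverse of k modulo the group order gives the inverse map.\<close>

lemma sum_pow_coprime:
  assumes "coprime k (card (carrier G))"
  shows "(\<Sum>x\<in>carrier G. F (x [^] k)) = (\<Sum>x\<in>carrier G. F x)"
proof -
  obtain k' where k': "[k * k' = 1] (mod card (carrier G))"
    using assms cong_solve_coprime_nat by auto
  have inv: "x [^] (k * k') = x" "x [^] (k' * k) = x" if "x \<in> carrier G" for x
    using pow_cong_card[OF that k'] that by (simp_all add: mult.commute)
  show ?thesis
    by (rule sum.reindex_bij_witness[of _ "\<lambda>x. x [^] k'" "\<lambda>x. x [^] k"]) (auto simp: nat_pow_pow inv)
qed

text \<open>Applying \<sigma> to the formula for \<mu> replaces \<open>E \<mu> h\<close> by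
  \<open>E \<mu> (h [^] k)\<close>. As f is unchanged under k-th powers, its argument can be raised
  as well, and reindexing restores the sum; the denominator sits at the identity and does not
  move.\<close>

lemma eigenvalue_fixed:
  assumes f: "class_function G f" and \<mu>: "\<mu> \<in> cayley_eigenvalues G f"
    and \<sigma>: "field_aut_C (cyclotomic_field (card (carrier G))) \<sigma>"
      "\<sigma> (zeta (card (carrier G))) = zeta (card (carrier G)) ^ k"
    and k: "k \<in> H_f G f (card (carrier G))"
  shows "\<sigma> \<mu> = \<mu>"
proof -
  let ?K = "cyclotomic_field (card (carrier G))"
  interpret complex_field_aut ?K \<sigma>
    using \<sigma>(1) by unfold_locales (simp_all add: cyclotomic_field_def subfield_gen_field)
  obtain E where E: "class_function G (E \<mu>)" "conv (E \<mu>) (E \<mu>) = E \<mu>"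
    "\<mu> = (\<Sum>h\<in>carrier G. of_rat (f (inv h)) * E \<mu> h) / E \<mu> \<one>"
    by (rule cayley_spectral_decomposition[OF f]) (use \<mu> in blast)
  note mem = central_idempotent_in_cyclotomic_field[OF E(1,2)]
  note gal = central_idempotent_galois[OF E(1,2) _ \<sigma>]
  let ?s = "\<Sum>h\<in>carrier G. of_rat (f (inv h)) * E \<mu> h"
  have sK: "?s \<in> ?K" using mem by auto
  have kk: "coprime k (card (carrier G))" "\<And>g. g \<in> carrier G \<Longrightarrow> f (g [^] k) = f g"
    using k by (auto simp: H_f_def units_mod_def)
  have "\<sigma> ?s = (\<Sum>h\<in>carrier G. of_rat (f (inv h)) * E \<mu> (h [^] k))"
    using mem gal by (subst hom_sum) (auto simp: hom_mult hom_Rats intro!: sum.cong)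
  also have "\<dots> = (\<Sum>h\<in>carrier G. of_rat (f (inv (h [^] k))) * E \<mu> (h [^] k))"
    using kk(2)[OF inv_closed] by (intro sum.cong) (simp_all add: nat_pow_inv)
  also have "\<dots> = ?s" by (rule sum_pow_coprime[OF kk(1)])
  finally have "\<sigma> ?s = ?s" .
  moreover have "\<sigma> (E \<mu> \<one>) = E \<mu> \<one>" using gal[of \<one>] by simp
  ultimately have "\<sigma> (?s / E \<mu> \<one>) = ?s / E \<mu> \<one>"
    unfolding divide_inverse using sK mem[of \<one>] by (simp add: hom_mult hom_inverse inverse_closed)
  then show ?thesis using E(3) by simp
qed

text \<open>Apply \<sigma> to the expansion of f(g): the left side is rational, and on the right
  only the idempotents move, which gives the expansion at \<open>g [^] k\<close>.\<close>

lemma stabilizer_of_eigenvalues: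
  assumes f: "class_function G f"
    and \<sigma>: "field_aut_C (cyclotomic_field (card (carrier G))) \<sigma>"
      "\<sigma> (zeta (card (carrier G))) = zeta (card (carrier G)) ^ k"
    and fixd: "\<And>\<mu>. \<mu> \<in> cayley_eigenvalues G f \<Longrightarrow> \<sigma> \<mu> = \<mu>" and g: "g \<in> carrier G"
  shows "f (g [^] k) = f g"
proof -
  let ?K = "cyclotomic_field (card (carrier G))"
  let ?S = "cayley_eigenvalues G f"
  interpret complex_field_aut ?K \<sigma>
    using \<sigma>(1) by unfold_locales (simp_all add: cyclotomic_field_def subfield_gen_field)
  obtain E where E: "\<And>\<mu>. \<mu> \<in> ?S \<Longrightarrow> class_function G (E \<mu>)" "\<And>\<mu>. \<mu> \<in> ?S \<Longrightarrow> conv (E \<mu>) (E \<mu>) = E \<mu>"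
    "\<And>g. g \<in> carrier G \<Longrightarrow> of_rat (f g) = (\<Sum>\<mu>\<in>?S. \<mu> * E \<mu> g)"
    by (rule cayley_spectral_decomposition[OF f]) blast
  note mem = central_idempotent_in_cyclotomic_field[OF E(1,2) g]
  note gal = central_idempotent_galois[OF E(1,2) g \<sigma>]
  have SK: "\<mu> \<in> ?K" if "\<mu> \<in> ?S" for \<mu> using cayley_eigenvalues_cyclotomic[OF f] that by blast
  have "of_rat (f g) = \<sigma> (of_rat (f g))" by (simp add: hom_Rats)
  also have "\<dots> = \<sigma> (\<Sum>\<mu>\<in>?S. \<mu> * E \<mu> g)" using E(3)[OF g] by simp
  also have "\<dots> = (\<Sum>\<mu>\<in>?S. \<sigma> (\<mu> * E \<mu> g))" using mem SK by (intro hom_sum) auto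
  also have "\<dots> = (\<Sum>\<mu>\<in>?S. \<mu> * E \<mu> (g [^] k))"
    using mem SK by (intro sum.cong) (auto simp: hom_mult gal fixd)
  also have "\<dots> = of_rat (f (g [^] k))" using E(3)[of "g [^] k"] g by simp
  finally show ?thesis by simp
qed

end

theorem mainTheorem6:
  fixes G :: "('a, 'b) monoid_scheme" (structure)
    and f :: "'a \<Rightarrow> rat" and n :: nat
  assumes "group G" and "finite (carrier G)" and "n = card (carrier G)"
    and "class_function G f"
    and "\<forall>g\<in>carrier G. f (inv\<^bsub>G\<^esub> g) = f g"
  shows "SF G f = fixed_field (cyclotomic_field n) (eta_preimage n (H_f G f n)) \<and>
         rat_of_nat (Deg G f) = rat_of_nat (totient n) / rat_of_nat (card (H_f G f n))"
proof -
  interpret finite_group G using assms(1,2) by (simp add: finite_group_def finite_group_axioms_def)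
  note n = assms(3) and f = assms(4)
  let ?K = "cyclotomic_field n"
  let ?H = "H_f G f n"
  let ?F = "SF G f"
  have n0: "0 < n" using card_carrier_pos n by simp
  have subK: "subfield_C ?K" by (simp add: cyclotomic_field_def subfield_gen_field)
  have subF: "subfield_C ?F" by (simp add: SF_def subfield_gen_field)
  have eigF: "cayley_eigenvalues G f \<subseteq> ?F" by (simp add: SF_def gen_field_contains)
  have FK: "?F \<subseteq> ?K"
    unfolding SF_def using cayley_eigenvalues_cyclotomic[OF f] n by (intro gen_field_minimal[OF subK]) simp
  have zK: "zeta n \<in> ?K" using gen_field_contains[of "{zeta n}"] by (simp add: cyclotomic_field_def)
  interpret K: complex_subfield ?K by standard (rule subK)
  obtain m where m: "is_minpoly ?F (zeta n) m" using cyclotomic_minpoly_exists[OF subF n0] by blast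
  interpret X: cyclotomic_extension ?F n m by unfold_locales (use subF n0 FK m in auto)
  obtain mQ where mQ: "is_minpoly \<rat> (zeta n) mQ"
    using cyclotomic_minpoly_exists[OF subfield_Rats n0] by blast
  interpret Y: cyclotomic_extension \<rat> n mQ
    by unfold_locales (use subfield_Rats n0 mQ K.Rats_subset in auto)
  \<comment> \<open>Irreducibility of the cyclotomic polynomial, used for the minimal polynomial
    over the rationals.\<close>
  have unitsQ: "Y.galois_exponents = units_mod n"
    using root_conjugate[OF n0] mQ by (auto simp: Y.galois_exponents_def units_mod_def is_minpoly_def)
  have fixF: "?F \<subseteq> fixed_field ?K (eta_preimage n ?H)"
    unfolding SF_def
  proof (rule gen_field_minimal)
    show "subfield_C (fixed_field ?K (eta_preimage n ?H))"
      by (rule subfield_fixed_field[OF subK]) (simp add: eta_preimage_def)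
    show "cayley_eigenvalues G f \<subseteq> fixed_field ?K (eta_preimage n ?H)"
      using eigenvalue_fixed[OF f] cayley_eigenvalues_cyclotomic[OF f] n
      by (auto simp: fixed_field_def eta_preimage_def)
  qed
  \<comment> \<open>The core of the argument: under eta, the Galois group over the splitting field
    is the stabiliser of f.\<close>
  have gal: "X.galois_exponents = ?H"
  proof
    show "X.galois_exponents \<subseteq> ?H"
    proof
      fix h assume h: "h \<in> X.galois_exponents"
      obtain \<sigma> where \<sigma>: "field_aut_C ?K \<sigma>"
        "\<And>p. p \<in> polys_over ?F \<Longrightarrow> \<sigma> (poly p (zeta n)) = poly p (zeta n ^ h)"
        using X.galois_automorphism[OF h] by blast
      have z: "\<sigma> (zeta n) = zeta n ^ h" using \<sigma>(2)[of "[:0, 1:]"] by simp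
      have "\<sigma> \<mu> = \<mu>" if "\<mu> \<in> cayley_eigenvalues G f" for \<mu>
        using \<sigma>(2)[of "[:\<mu>:]"] that eigF by auto
      then have "f (g [^] h) = f g" if "g \<in> carrier G" for g
        using stabilizer_of_eigenvalues[OF f, of \<sigma> h g] \<sigma>(1) z that n by simp
      then show "h \<in> ?H" using h by (auto simp: H_f_def X.galois_exponents_def)
    qed
    show "?H \<subseteq> X.galois_exponents"
    proof
      fix h assume h: "h \<in> ?H"
      then have hu: "h \<in> units_mod n" by (simp add: H_f_def)
      \<comment> \<open>The automorphism is built over the rationals, where every unit is available;
        that it exists over \<open>?F\<close> is what is being shown.\<close>
      then obtain \<sigma> where \<sigma>: "field_aut_C ?K \<sigma>"
        "\<And>p. p \<in> polys_over \<rat> \<Longrightarrow> \<sigma> (poly p (zeta n)) = poly p (zeta n ^ h)"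
        using Y.galois_automorphism[of h] unitsQ by blast
      have z: "\<sigma> (zeta n) = zeta n ^ h" using \<sigma>(2)[of "[:0, 1:]"] by simp
      have "\<sigma> \<in> eta_preimage n ?H" using \<sigma>(1) z h by (auto simp: eta_preimage_def)
      then have fixd: "\<sigma> x = x" if "x \<in> ?F" for x using fixF that by (auto simp: fixed_field_def)
      have mF: "m \<in> polys_over ?F" "poly m (zeta n) = 0" using m by (auto simp: is_minpoly_def)
      \<comment> \<open>The coefficients of m lie in \<open>?F\<close> and are fixed, so the root
        zeta is moved to another root of m.\<close>
      have "\<sigma> (poly m (zeta n)) = poly m (\<sigma> (zeta n))"
        by (rule field_aut_poly[OF subK \<sigma>(1) _ _ zK]) (use mF(1) FK fixd in \<open>auto simp: polys_over_def\<close>)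
      then have "poly m (zeta n ^ h) = 0" using mF(2) z field_aut_zero[OF subK \<sigma>(1)] by simp
      then show "h \<in> X.galois_exponents" using hu by (simp add: X.galois_exponents_def)
    qed
  qed
  have "fixed_field ?K (eta_preimage n ?H) \<subseteq> ?F"
  proof
    fix x assume x: "x \<in> fixed_field ?K (eta_preimage n ?H)"
    then have "x \<in> ?K" by (simp add: fixed_field_def)
    then obtain p where p: "p \<in> polys_over ?F" "x = poly p (zeta n)"
      using X.K_eq_adjoin by (auto simp: adjoin_def)
    have "poly p (zeta n ^ h) = poly p (zeta n)" if h: "h \<in> X.galois_exponents" for h
    proof -
      obtain \<sigma> where \<sigma>: "field_aut_C ?K \<sigma>"
        "\<And>p. p \<in> polys_over ?F \<Longrightarrow> \<sigma> (poly p (zeta n)) = poly p (zeta n ^ h)"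
        using X.galois_automorphism[OF h] by blast
      have "\<sigma> (zeta n) = zeta n ^ h" using \<sigma>(2)[of "[:0, 1:]"] by simp
      then have "\<sigma> \<in> eta_preimage n ?H" using \<sigma>(1) h gal by (auto simp: eta_preimage_def)
      then have "\<sigma> x = x" using x by (simp add: fixed_field_def)
      then show ?thesis using \<sigma>(2)[OF p(1)] p(2) by simp
    qed
    then show "x \<in> ?F" using X.fixed_by_all_conjugations[OF p(1)] p(2) by simp
  qed
  with fixF have "?F = fixed_field ?K (eta_preimage n ?H)" by blast
  \<comment> \<open>The degree of the cyclotomic field over the rationals, computed once directly
    and once through \<open>?F\<close>.\<close>
  moreover have "totient n = Deg G f * card ?H"
    using X.rat_degree_cyclotomic_field Y.rat_degree_cyclotomic_field
    by (simp add: gal unitsQ rat_degree_Rats card_units_mod[OF n0] Deg_def)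
  \<comment> \<open>Needed to divide, as a quotient by 0 would be 0; the cardinality is the positive
    degree of m.\<close>
  moreover have "card ?H \<noteq> 0"
    using X.card_galois_exponents X.degree_minpoly_pos[OF m] gal by simp
  ultimately show ?thesis by simp
qed

end
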